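(* Let $(\Omega,d)$ be a Polish metric space, let $(X_t)_{t\ge 0}$ be a time-inhomogeneous Markov chain on $\Omega$ with initial distribution $\mu_0$ and Markov kernels $(P_t)_{t\ge 1}$, and let $F_t:\Omega\to \mathsf{H}_m$, $t\ge 1$. Assume: (1) for all $t\ge 1$ the curvature $\kappa_t$ of $P_t$ lies in $[0,1]$, and there exists $\kappa\in(0,1]$ such that for all $t\ge 1$ $$1+\sum_{k=1}^{t}\ \prod_{\ell=k}^{t}(1-\kappa_\ell)\ \le\ \frac1\kappa ;$$ (2) $D:=\sup_{x,y\in\Omega}d(x,y)<\infty$; (3) there exists $L>0$ such that $\mathrm{Lip}(F_t)^{\mathrm{op}}\le L$ for all $t$. Let $v^2:=\frac{192}{\pi^2}\frac{L^2D^2}{\kappa}$. Then for every integer $n\ge 1$ and all $\varepsilon\ge 0$, $$\mathbb{P}_{\mu_0}\Big(\lambda_{\max}\Big(\sum_{j=1}^n (F_j(X_j)-\mathbb{E}F_j(X_j))\Big)\ge n\varepsilon\Big)\le m^{2-\pi/4}\exp\left(-\frac{n\varepsilon^2}{2v^2}\right).$$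
   Context: $\mathsf{H}_m$ is the set of $m\times m$ complex Hermitian matrices, $\lambda_{\max}$ the largest eigenvalue, $\|\cdot\|_{\mathrm{op}}$ the operator norm. A time-inhomogeneous Markov chain with kernels $P_t$ satisfies $\mathbb{P}(X_t\in A\mid X_{t-1}=x)=P_t(x,A)$ for $t\ge1$; $\mathbb{P}_{\mu_0}$ and $\mathbb{E}$ refer to the path law with $X_0\sim\mu_0$. Operator Lipschitz seminorm: for $F:\Omega\to\mathbb{C}^{m\times m}$, $\mathrm{Lip}(F)^{\mathrm{op}}:=\sup_{x\ne y}\|F(x)-F(y)\|_{\mathrm{op}}/d(x,y)$. Curvature at time $t$: $\kappa_t:=\inf_{x\ne y}\Big(1-\frac{W_1(P_t(x,\cdot),P_t(y,\cdot))}{d(x,y)}\Big)$, where $W_1$ is the Wasserstein-1 distance $W_1(\mu,\nu)=\inf_{\pi\in\Pi(\mu,\nu)}\int d(x,y)\,d\pi(x,y)$ and $\Pi(\mu,\nu)$ is the set of couplings of $\mu$ and $\nu$. *)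

theory Defs
  imports "HOL-Probability.Probability"
begin

definition hermitian :: "complex^'m^'m \<Rightarrow> bool" where
  "hermitian A \<longleftrightarrow> (\<forall>i j. A $ i $ j = cnj (A $ j $ i))"

definition is_eigenvalue :: "complex^'m^'m \<Rightarrow> complex \<Rightarrow> bool" where
  "is_eigenvalue A c \<longleftrightarrow> (\<exists>v. v \<noteq> 0 \<and> A *v v = c *s v)"

text \<open>Intended for Hermitian matrices, whose spectrum is a finite nonempty set of reals.\<close>

definition lambda_max :: "complex^'m^'m \<Rightarrow> real" where
  "lambda_max A = Max {r. is_eigenvalue A (complex_of_real r)}"

definition op_norm :: "complex^'m^'m \<Rightarrow> real" where
  "op_norm A = onorm (\<lambda>v. A *v v)"

definition op_Lip :: "('a::metric_space \<Rightarrow> complex^'m^'m) \<Rightarrow> ennreal" where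
  "op_Lip F = (SUP (x, y) \<in> {(x, y). x \<noteq> y}. ennreal (op_norm (F x - F y) / dist x y))"

definition couplings :: "'a measure \<Rightarrow> 'b measure \<Rightarrow> ('a \<times> 'b) measure set" where
  "couplings \<mu> \<nu> =
     {\<pi>. sets \<pi> = sets (\<mu> \<Otimes>\<^sub>M \<nu>) \<and> distr \<pi> \<mu> fst = \<mu> \<and> distr \<pi> \<nu> snd = \<nu>}"

definition W1 :: "'a::metric_space measure \<Rightarrow> 'a measure \<Rightarrow> ennreal" where
  "W1 \<mu> \<nu> = (INF \<pi> \<in> couplings \<mu> \<nu>. \<integral>\<^sup>+ (x, y). ennreal (dist x y) \<partial>\<pi>)"

text \<open>The infimum is taken in the extended reals, so on a one-point space the curvature is
  \<open>\<infinity>\<close>.\<close>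

definition curvature :: "('a::metric_space \<Rightarrow> 'a measure) \<Rightarrow> ereal" where
  "curvature K =
     (INF (x, y) \<in> {(x, y). x \<noteq> y}. 1 - enn2ereal (W1 (K x) (K y)) / ereal (dist x y))"

definition past :: "'w measure \<Rightarrow> (nat \<Rightarrow> 'w \<Rightarrow> 'a::topological_space) \<Rightarrow> nat \<Rightarrow> 'w measure" where
  "past M X t = sigma (space M) {X s -` A \<inter> space M | s A. s \<le> t \<and> A \<in> sets borel}"

text \<open>\<open>P t\<close> is the transition kernel from time \<open>t - 1\<close> to time \<open>t\<close>; the value \<open>P 0\<close> is irrelevant.
  The conditional law of \<open>X t\<close> is required given the whole past up to time \<open>t - 1\<close>, which
  combines the Markov property with the prescribed one-step transition probabilities.\<close>

definition markov_chain ::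
  "'w measure \<Rightarrow> (nat \<Rightarrow> 'w \<Rightarrow> 'a::topological_space) \<Rightarrow> 'a measure \<Rightarrow> (nat \<Rightarrow> 'a \<Rightarrow> 'a measure) \<Rightarrow> bool"
where
  "markov_chain M X \<mu>\<^sub>0 P \<longleftrightarrow>
     prob_space M \<and>
     (\<forall>t. X t \<in> borel_measurable M) \<and>
     distr M borel (X 0) = \<mu>\<^sub>0 \<and>
     (\<forall>t\<ge>1. P t \<in> borel \<rightarrow>\<^sub>M prob_algebra borel) \<and>
     (\<forall>t\<ge>1. \<forall>A\<in>sets borel. AE \<omega> in M.
        real_cond_exp M (past M X (t - 1)) (\<lambda>\<omega>. indicator A (X t \<omega>)) \<omega>
          = measure (P t (X (t - 1) \<omega>)) A)"

end

theory Submission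
  imports Defs
begin

text \<open>
  Write \<open>K = 1/\<kappa>\<close> and let \<open>S\<close> be the centred sum.  The bound is an Azuma inequality for the Doob
  martingale of \<open>S\<close>, observed only at the ends of blocks of about \<open>K\<close> consecutive times.  Observing
  it at every time would be too wasteful: a single step may change the conditional expectation of
  \<open>S\<close> by about \<open>L D K\<close>, and \<open>n\<close> such steps produce the variance proxy \<open>n (L D K)\<^sup>2\<close>, which has one
  factor \<open>K\<close> too many.  A whole block of length \<open>K\<close> changes the conditional expectation by no more
  than \<open>3 L D K\<close>, and there are only about \<open>n / K\<close> blocks, so the proxy is at most
  \<open>(2 n / K) (3 L D K)\<^sup>2 = 18 n K (L D)\<^sup>2\<close>.  Since \<open>18 \<le> 192 / \<pi>\<^sup>2\<close>, this is below \<open>n v\<^sup>2\<close>.  When \<open>n\<close> does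
  not exceed the block length, a single block with increment \<open>L D n\<close> is good enough.

  The size of a block increment has two parts.  The observables inside the block contribute at most
  \<open>L D\<close> each.  Those after the block contribute through forecasts: by the coupling definition of
  \<open>W\<^sub>1\<close>, a kernel of curvature \<open>\<kappa>\<^sub>l\<close> shrinks Lipschitz constants by \<open>1 - \<kappa>\<^sub>l\<close>
  (\<open>curvature_contraction\<close>), so the forecast at time \<open>k\<close> of the observable at time \<open>j\<close> oscillates
  by at most \<open>L D (1 - \<kappa>\<^bsub>k+1\<^esub>) \<dots> (1 - \<kappa>\<^sub>j)\<close>.  These products have to be summed over the end
  time \<open>j\<close>, whereas the hypothesis bounds their sums over the starting time.  The two are linked by
  an invariant of the recursions they satisfy: the sum over end times plus the sum over starting times
  is at most \<open>2 K\<close> (\<open>row_sum_plus_column_sum_le\<close>).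

  The matrix form of the Azuma inequality (\<open>matrix_azuma\<close>) bounds the Laplace transform
  \<open>E tr exp(\<theta> A)\<close> along the martingale.  The exponential is approximated by the power
  \<open>(1 + \<theta> A / N)\<^sup>N\<close>, \<open>N \<rightarrow> \<infinity>\<close>, whose trace along a segment \<open>A + s Y\<close> is a polynomial in \<open>s\<close>.
  In an eigenbasis of the positive operator \<open>B = N + \<theta> A\<close>, its second derivative is seen to be at most
  \<open>\<rho>\<^sup>2\<close> times the trace itself, with \<open>\<rho>\<close> close to \<open>\<theta> |Y|\<close>; comparison with the solutions of
  \<open>u'' = \<rho>\<^sup>2 u\<close> gives
  \<open>tr (B + \<theta> Y)\<^sup>N \<le> cosh \<rho> tr B\<^sup>N + (sinh \<rho> / \<rho>) N \<theta> tr (Y B\<^bsup>N-1\<^esup>)\<close>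
  (\<open>rtrace_power_cosh\<close>).  The last trace is linear in the martingale increment \<open>Y\<close>, so its
  expectation vanishes, and each increment costs one factor \<open>cosh \<rho>\<close>, which tends to
  \<open>cosh (\<theta> R) \<le> exp (\<theta>\<^sup>2 R\<^sup>2 / 2)\<close> when the increments are bounded by \<open>R\<close>.  Markov's inequality then
  yields the tail bound with prefactor \<open>m\<close>, and \<open>m \<le> m\<^bsup>2-\<pi>/4\<^esup>\<close>.
\<close>

section \<open>Self-adjoint operators on a Euclidean space\<close>

text \<open>Complex matrices are studied as real-linear operators on the real Euclidean space underlying
  \<open>\<complex>\<^sup>m\<close>: everything about Hermitian matrices that is used below is a statement about
  self-adjoint operators and their orthonormal bases of eigenvectors.\<close>
definition selfadj :: "('h::real_inner \<Rightarrow> 'h) \<Rightarrow> bool" where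
  "selfadj f \<longleftrightarrow> linear f \<and> (\<forall>x y. f x \<bullet> y = x \<bullet> f y)"

definition onb :: "'h::euclidean_space set \<Rightarrow> bool" where
  "onb C \<longleftrightarrow> pairwise orthogonal C \<and> (\<forall>c\<in>C. norm c = 1) \<and> span C = UNIV"

text \<open>For the operator of a complex matrix this is twice the real part of the complex trace, because
  the real dimension is twice the complex one.\<close>
definition rtrace :: "('h::euclidean_space \<Rightarrow> 'h) \<Rightarrow> real" where
  "rtrace f = (\<Sum>b\<in>Basis. f b \<bullet> b)"

text \<open>A maximiser \<open>u\<close> of the quadratic form \<open>x \<bullet> f x\<close> on the unit sphere of the subspace is an
  eigenvector.\<close>
lemma selfadj_invariant_eigenvector:
  fixes f :: "'h::euclidean_space \<Rightarrow> 'h"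
  assumes f: "selfadj f" and S: "subspace S" "\<And>x. x \<in> S \<Longrightarrow> f x \<in> S" and ne: "S \<noteq> {0}"
  obtains u r where "u \<in> S" "norm u = 1" "f u = r *\<^sub>R u"
proof -
  have lin: "linear f" and sa: "\<And>x y. f x \<bullet> y = x \<bullet> f y"
    using f by (auto simp: selfadj_def)
  let ?K = "S \<inter> sphere 0 1"
  obtain y where y: "y \<in> S" "y \<noteq> 0"
    using ne S(1) subspace_0 by blast
  have "(1 / norm y) *\<^sub>R y \<in> ?K"
    using y S(1) by (auto simp: subspace_scale)
  then have "?K \<noteq> {}" by blast
  moreover have "compact ?K"
    using closed_subspace[OF S(1)] compact_sphere by (simp add: closed_Int_compact)
  moreover have "continuous_on ?K (\<lambda>x. x \<bullet> f x)"
    using lin by (intro continuous_intros linear_continuous_on) (simp add: linear_conv_bounded_linear)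
  ultimately obtain u where u: "u \<in> ?K" "\<And>x. x \<in> ?K \<Longrightarrow> x \<bullet> f x \<le> u \<bullet> f u"
    using continuous_attains_sup by metis
  define r where "r = u \<bullet> f u"
  have uu: "u \<bullet> u = 1" using u(1) by (simp add: norm_eq_1)
  have q: "0 \<le> r * (x \<bullet> x) - x \<bullet> f x" if "x \<in> S" for x
  proof (cases "x = 0")
    case True
    then show ?thesis by simp
  next
    case False
    have "(1 / norm x) *\<^sub>R x \<in> ?K" using that False S(1) by (auto simp: subspace_scale)
    from u(2)[OF this] have "(1 / norm x)^2 * (x \<bullet> f x) \<le> r"
      by (simp add: r_def linear_scale[OF lin] power2_eq_square)
    then have "x \<bullet> f x \<le> r * (norm x)^2"
      using False by (simp add: power_divide divide_simps mult.commute)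
    then show ?thesis by (simp add: power2_norm_eq_inner)
  qed
  define w where "w = r *\<^sub>R u - f u"
  have wS: "w \<in> S" unfolding w_def using u(1) S by (auto intro: subspace_diff subspace_scale)
  define c where "c = r * (w \<bullet> w) - w \<bullet> f w"
  \<comment> \<open>The form \<open>r (x \<bullet> x) - x \<bullet> f x\<close> is nonnegative on \<open>S\<close> and vanishes at \<open>u\<close>, so its derivative
    at \<open>u\<close> in the direction \<open>w\<close>, which is \<open>2 (w \<bullet> w)\<close>, must be zero.\<close>
  have expand: "r * ((u + t *\<^sub>R w) \<bullet> (u + t *\<^sub>R w)) - (u + t *\<^sub>R w) \<bullet> f (u + t *\<^sub>R w)
      = t * (2 * (w \<bullet> w)) + t^2 * c" for t
  proof -
    have e1: "(u + t *\<^sub>R w) \<bullet> (u + t *\<^sub>R w) = 1 + 2 * t * (u \<bullet> w) + t^2 * (w \<bullet> w)"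
      using inner_commute[of w u] uu
      by (simp add: inner_add_left inner_add_right power2_eq_square algebra_simps)
    have e2: "(u + t *\<^sub>R w) \<bullet> f (u + t *\<^sub>R w) = r + 2 * t * (f u \<bullet> w) + t^2 * (w \<bullet> f w)"
      using inner_commute[of w "f u"] sa[of u w]
      by (simp add: linear_add[OF lin] linear_scale[OF lin] inner_add_left inner_add_right
          r_def power2_eq_square distrib_left)
    have e3: "w \<bullet> w = r * (u \<bullet> w) - f u \<bullet> w"
    proof -
      have "w \<bullet> w = (r *\<^sub>R u - f u) \<bullet> w" using w_def by simp
      then show ?thesis by (simp add: inner_diff_left)
    qed
    have "r * (1 + 2 * t * (u \<bullet> w) + t^2 * (w \<bullet> w)) - (r + 2 * t * (f u \<bullet> w) + t^2 * (w \<bullet> f w))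
      = t * (2 * (r * (u \<bullet> w) - f u \<bullet> w)) + t^2 * c"
      unfolding c_def by (simp only: algebra_simps)
    then show ?thesis unfolding e1 e2 by (simp only: e3)
  qed
  have nonneg: "0 \<le> t * (2 * (w \<bullet> w)) + t^2 * c" for t
    unfolding expand[symmetric] using u(1) wS S(1)
    by (intro q) (auto intro: subspace_add subspace_scale)
  have "w \<bullet> w = 0"
  proof (rule ccontr)
    assume "w \<bullet> w \<noteq> 0"
    then have pos: "w \<bullet> w > 0" by simp
    \<comment> \<open>A negative step so small that the linear term dominates the quadratic one.\<close>
    define t where "t = - (w \<bullet> w) / (\<bar>c\<bar> + 1)"
    have tneg: "t < 0" unfolding t_def using pos by (simp add: divide_neg_pos)
    have "\<bar>t * c\<bar> \<le> (w \<bullet> w) * 1"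
    proof -
      have "\<bar>t * c\<bar> = (w \<bullet> w) * (\<bar>c\<bar> / (\<bar>c\<bar> + 1))"
        unfolding t_def by (simp add: abs_mult abs_divide)
      also have "\<dots> \<le> (w \<bullet> w) * 1" by (intro mult_left_mono) auto
      finally show ?thesis .
    qed
    then have "0 < 2 * (w \<bullet> w) + t * c" using pos by linarith
    then have "t * (2 * (w \<bullet> w) + t * c) < 0" using tneg by (simp add: mult_neg_pos)
    with nonneg[of t] show False by (simp add: power2_eq_square algebra_simps)
  qed
  then have "f u = r *\<^sub>R u" unfolding w_def by simp
  with u(1) show ?thesis by (intro that[of u r]) auto
qed

text \<open>The orthogonal complement of an eigenvector inside an invariant subspace is again invariant.\<close>
lemma selfadj_invariant_eigenbasis:
  fixes f :: "'h::euclidean_space \<Rightarrow> 'h"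
  assumes f: "selfadj f" and "subspace S" "\<And>x. x \<in> S \<Longrightarrow> f x \<in> S"
  shows "\<exists>C. pairwise orthogonal C \<and> (\<forall>c\<in>C. norm c = 1) \<and> span C = S \<and> (\<forall>c\<in>C. \<exists>r. f c = r *\<^sub>R c)"
  using assms(2,3)
proof (induction "dim S" arbitrary: S rule: less_induct)
  case less
  show ?case
  proof (cases "S = {0}")
    case True
    then show ?thesis by (intro exI[of _ "{}"]) auto
  next
    case False
    obtain u r where u: "u \<in> S" "norm u = 1" "f u = r *\<^sub>R u"
      using selfadj_invariant_eigenvector[OF f less.prems False] by metis
    define T where "T = {x \<in> S. x \<bullet> u = 0}"
    have subT: "subspace T"
      unfolding T_def subspace_def using less.prems(1)
      by (auto simp: inner_add_left subspace_add subspace_scale subspace_0)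
    have "u \<notin> T" using u by (auto simp: T_def)
    then have "dim T < dim S"
    proof (intro dim_psubset)
      have sp: "span T = T" "span S = S" using subT less.prems(1) by (simp_all add: span_eq_iff)
      have "T \<subset> S" using u(1) \<open>u \<notin> T\<close> T_def by blast
      then show "span T \<subset> span S" unfolding sp .
    qed
    moreover have "f x \<in> T" if "x \<in> T" for x
      using that less.prems(2) u(3) f by (auto simp: T_def selfadj_def)
    ultimately obtain C where C: "pairwise orthogonal C" "\<forall>c\<in>C. norm c = 1" "span C = T"
      "\<forall>c\<in>C. \<exists>r. f c = r *\<^sub>R c"
      using less.hyps[of T] subT by metis
    have CT: "C \<subseteq> T" using C(3) span_superset by blast
    have "pairwise orthogonal (insert u C)"
      using C(1) CT unfolding pairwise_insert by (auto simp: T_def orthogonal_def inner_commute)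
    moreover have "span (insert u C) = S"
    proof (intro antisym subsetI)
      show "x \<in> S" if "x \<in> span (insert u C)" for x
        using that span_minimal[of "insert u C" S] u(1) CT less.prems(1) by (auto simp: T_def)
      show "x \<in> span (insert u C)" if "x \<in> S" for x
      proof -
        have "x - (x \<bullet> u) *\<^sub>R u \<in> T"
          using that u less.prems(1)
          by (auto simp: T_def inner_diff_left norm_eq_1 subspace_diff subspace_scale)
        then show ?thesis using C(3) by (auto simp: span_insert)
      qed
    qed
    ultimately show ?thesis
      using C u by (intro exI[of _ "insert u C"]) auto
  qed
qed

lemma selfadj_eigenbasis:
  fixes f :: "'h::euclidean_space \<Rightarrow> 'h"
  assumes "selfadj f"
  obtains C r where "onb C" "\<And>c. c \<in> C \<Longrightarrow> f c = r c *\<^sub>R c"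
proof -
  obtain C where "onb C" "\<forall>c\<in>C. \<exists>r. f c = r *\<^sub>R c"
    using selfadj_invariant_eigenbasis[OF assms, of UNIV] by (auto simp: onb_def)
  moreover from this(2) obtain r where "\<forall>c\<in>C. f c = r c *\<^sub>R c" by metis
  ultimately show ?thesis by (intro that[of C r]) auto
qed

lemma onb_finite: "onb C \<Longrightarrow> finite C"
  unfolding onb_def by (rule pairwise_orthogonal_imp_finite) simp

lemma onb_Basis: "onb Basis"
  unfolding onb_def using inner_not_same_Basis
  by (auto simp: pairwise_def orthogonal_def inner_Basis)

lemma onb_expand: "onb C \<Longrightarrow> (\<Sum>c\<in>C. (x \<bullet> c) *\<^sub>R c) = x"
  using orthonormal_basis_expand[of C x] onb_finite[of C] by (auto simp: onb_def)

lemma onb_inner: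
  assumes "onb C" shows "x \<bullet> y = (\<Sum>c\<in>C. (x \<bullet> c) * (y \<bullet> c))"
proof -
  have "x \<bullet> y = (\<Sum>c\<in>C. (x \<bullet> c) *\<^sub>R c) \<bullet> y" using onb_expand[OF assms, of x] by simp
  then show ?thesis by (simp add: inner_sum_left inner_commute[of y])
qed

lemma onb_linear:
  assumes "onb C" "linear f"
  shows "f x \<bullet> y = (\<Sum>c\<in>C. (x \<bullet> c) * (f c \<bullet> y))"
proof -
  have "f x = f (\<Sum>c\<in>C. (x \<bullet> c) *\<^sub>R c)" using onb_expand[OF assms(1), of x] by simp
  also have "\<dots> = (\<Sum>c\<in>C. (x \<bullet> c) *\<^sub>R f c)"
    using assms(2) by (simp add: linear_sum linear_scale)
  finally show ?thesis by (simp add: inner_sum_left)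
qed

lemma rtrace_compose_onb:
  assumes C: "onb C" and D: "onb D" and "linear f" "linear g"
  shows "(\<Sum>c\<in>C. f (g c) \<bullet> c) = (\<Sum>d\<in>D. g (f d) \<bullet> d)"
proof -
  have "(\<Sum>c\<in>C. f (g c) \<bullet> c) = (\<Sum>c\<in>C. \<Sum>d\<in>D. (g c \<bullet> d) * (f d \<bullet> c))"
    by (intro sum.cong refl onb_linear[OF D assms(3)])
  also have "\<dots> = (\<Sum>d\<in>D. \<Sum>c\<in>C. (f d \<bullet> c) * (g c \<bullet> d))"
    by (subst sum.swap) (simp add: mult.commute)
  also have "\<dots> = (\<Sum>d\<in>D. g (f d) \<bullet> d)"
    by (intro sum.cong refl onb_linear[OF C assms(4), symmetric])
  finally show ?thesis .
qed

lemma rtrace_onb: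
  assumes "onb C" "linear f"
  shows "rtrace f = (\<Sum>c\<in>C. f c \<bullet> c)"
  unfolding rtrace_def
  using rtrace_compose_onb[OF onb_Basis assms(1) assms(2) linear_ident] .

lemma rtrace_cyclic:
  assumes "linear f" "linear g"
  shows "rtrace (\<lambda>x. f (g x)) = rtrace (\<lambda>x. g (f x))"
  unfolding rtrace_def by (rule rtrace_compose_onb[OF onb_Basis onb_Basis assms])

lemma linear_funpow:
  fixes f :: "'h::real_vector \<Rightarrow> 'h"
  shows "linear f \<Longrightarrow> linear (f ^^ k)"
  by (induction k) (auto intro: linear_compose linear_ident simp: id_def)

lemma funpow_eigen:
  fixes f :: "'h::real_vector \<Rightarrow> 'h"
  assumes "linear f" "f c = r *\<^sub>R c"
  shows "(f ^^ k) c = (r ^ k) *\<^sub>R c"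
  by (induction k) (auto simp: assms linear_scale mult.commute)

section \<open>The trace of a power along a segment\<close>

text \<open>The right-hand side is the value at 1 of the solution of \<open>f'' = \<rho>\<^sup>2 f\<close> with the same initial
  data as \<open>u\<close>.  Factoring the operator as \<open>(d/ds - \<rho>) (d/ds + \<rho>)\<close> turns the second-order
  inequality into two monotonicity statements.\<close>
lemma cosh_comparison:
  fixes u u' u'' :: "real \<Rightarrow> real"
  assumes "\<rho> > 0"
    and d1: "\<And>s. 0 \<le> s \<Longrightarrow> s \<le> 1 \<Longrightarrow> (u has_real_derivative u' s) (at s)"
    and d2: "\<And>s. 0 \<le> s \<Longrightarrow> s \<le> 1 \<Longrightarrow> (u' has_real_derivative u'' s) (at s)"
    and le: "\<And>s. 0 \<le> s \<Longrightarrow> s \<le> 1 \<Longrightarrow> u'' s \<le> \<rho>\<^sup>2 * u s"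
  shows "u 1 \<le> cosh \<rho> * u 0 + sinh \<rho> / \<rho> * u' 0"
proof -
  define c where "c = u' 0 + \<rho> * u 0"
  \<comment> \<open>First factor: \<open>u' + \<rho> u\<close> grows at most like \<open>exp (\<rho> s)\<close>.\<close>
  have h: "exp (- \<rho> * s) * (u' s + \<rho> * u s) \<le> c" if "0 \<le> s" "s \<le> 1" for s
  proof -
    have "exp (- \<rho> * s) * (u' s + \<rho> * u s) \<le> exp (- \<rho> * 0) * (u' 0 + \<rho> * u 0)"
    proof (rule DERIV_nonpos_imp_nonincreasing[OF that(1)])
      fix x assume x: "0 \<le> x" "x \<le> s"
      then have x1: "x \<le> 1" using that by simp
      have "((\<lambda>s. exp (- \<rho> * s) * (u' s + \<rho> * u s)) has_real_derivative
          exp (- \<rho> * x) * (u'' x - \<rho>\<^sup>2 * u x)) (at x)"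
        by (rule derivative_eq_intros d1[OF x(1) x1] d2[OF x(1) x1] refl)+
          (simp add: algebra_simps power2_eq_square)
      moreover have "exp (- \<rho> * x) * (u'' x - \<rho>\<^sup>2 * u x) \<le> 0"
        using le[OF x(1) x1] by (simp add: mult_le_0_iff)
      ultimately show "\<exists>y. ((\<lambda>s. exp (- \<rho> * s) * (u' s + \<rho> * u s)) has_real_derivative y) (at x) \<and> y \<le> 0"
        by blast
    qed
    then show ?thesis by (simp add: c_def)
  qed
  \<comment> \<open>Second factor: integrate \<open>(exp (\<rho> s) u)' \<le> c exp (2 \<rho> s)\<close>.\<close>
  have "exp (\<rho> * 1) * u 1 - c * exp (2 * \<rho> * 1) / (2 * \<rho>)
      \<le> exp (\<rho> * 0) * u 0 - c * exp (2 * \<rho> * 0) / (2 * \<rho>)"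
  proof (rule DERIV_nonpos_imp_nonincreasing[of 0 1 "\<lambda>s. exp (\<rho> * s) * u s - c * exp (2 * \<rho> * s) / (2 * \<rho>)"])
    fix x :: real assume x: "0 \<le> x" "x \<le> 1"
    have "((\<lambda>s. exp (\<rho> * s) * u s - c * exp (2 * \<rho> * s) / (2 * \<rho>)) has_real_derivative
        exp (\<rho> * x) * (u' x + \<rho> * u x) - c * exp (2 * \<rho> * x)) (at x)"
      using \<open>\<rho> > 0\<close>
      by - ((rule derivative_eq_intros d1[OF x] refl | simp)+, simp add: algebra_simps)
    moreover have "exp (\<rho> * x) * (u' x + \<rho> * u x) - c * exp (2 * \<rho> * x) \<le> 0"
    proof -
      have "exp (\<rho> * x) * (u' x + \<rho> * u x)
          = exp (2 * \<rho> * x) * (exp (- \<rho> * x) * (u' x + \<rho> * u x))"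
        by (simp add: mult.assoc[symmetric] exp_add[symmetric])
      also have "\<dots> \<le> exp (2 * \<rho> * x) * c" by (intro mult_left_mono h x) simp
      finally show ?thesis by (simp add: mult.commute)
    qed
    ultimately show "\<exists>y. ((\<lambda>s. exp (\<rho> * s) * u s - c * exp (2 * \<rho> * s) / (2 * \<rho>))
        has_real_derivative y) (at x) \<and> y \<le> 0" by blast
  qed simp
  then have "exp \<rho> * u 1 \<le> u 0 + c * ((exp \<rho>)\<^sup>2 - 1) / (2 * \<rho>)"
    by (simp add: exp_double[symmetric] mult.commute diff_divide_distrib right_diff_distrib)
  then have "u 1 \<le> (u 0 + c * ((exp \<rho>)\<^sup>2 - 1) / (2 * \<rho>)) / exp \<rho>"
    by (simp add: pos_le_divide_eq mult.commute)
  also have "\<dots> = cosh \<rho> * u 0 + sinh \<rho> / \<rho> * u' 0"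
    using \<open>\<rho> > 0\<close> unfolding c_def cosh_field_def sinh_field_def
    by (simp add: exp_minus field_simps power2_eq_square)
  finally show ?thesis .
qed

text \<open>The function \<open>- exp (x\<^sup>2 s\<^sup>2 / 2)\<close> satisfies the hypothesis of the comparison lemma with
  \<open>\<rho> = |x|\<close>, and its derivative vanishes at 0.\<close>
lemma cosh_le_exp_square: "cosh x \<le> exp (x\<^sup>2 / 2)" for x :: real
proof (cases "x = 0")
  case False
  define u where "u = (\<lambda>s. - exp ((x * s)\<^sup>2 / 2))"
  have "u 1 \<le> cosh \<bar>x\<bar> * u 0 + sinh \<bar>x\<bar> / \<bar>x\<bar> * (x\<^sup>2 * 0 * u 0)"
  proof (rule cosh_comparison[where u'' = "\<lambda>s. x\<^sup>2 * u s + x\<^sup>2 * s * (x\<^sup>2 * s * u s)"])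
    show du: "(u has_real_derivative x\<^sup>2 * s * u s) (at s)" for s
      unfolding u_def by (rule derivative_eq_intros refl | simp)+ (simp add: power2_eq_square)
    show "((\<lambda>s. x\<^sup>2 * s * u s) has_real_derivative x\<^sup>2 * u s + x\<^sup>2 * s * (x\<^sup>2 * s * u s)) (at s)" for s
      by (rule derivative_eq_intros du refl | simp)+
    show "x\<^sup>2 * u s + x\<^sup>2 * s * (x\<^sup>2 * s * u s) \<le> \<bar>x\<bar>\<^sup>2 * u s" for s
    proof -
      have "x\<^sup>2 * s * (x\<^sup>2 * s * u s) = - ((x\<^sup>2 * s)\<^sup>2 * exp ((x * s)\<^sup>2 / 2))"
        by (simp add: u_def power2_eq_square)
      moreover have "0 \<le> (x\<^sup>2 * s)\<^sup>2 * exp ((x * s)\<^sup>2 / 2)" by (intro mult_nonneg_nonneg) auto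
      ultimately show ?thesis by simp
    qed
  qed (use False in simp)
  then show ?thesis by (simp add: u_def cosh_real_abs)
qed simp

text \<open>Pair the terms \<open>i\<close> and \<open>n - i\<close>: the powers \<open>a\<^sup>i - b\<^sup>i\<close> and \<open>a\<^bsup>n-i\<^esup> - b\<^bsup>n-i\<^esup>\<close>
  have the same sign.\<close>
lemma power_mix_sum_le:
  fixes a b :: real
  assumes "a \<ge> 0" "b \<ge> 0"
  shows "(\<Sum>i<Suc n. a ^ (n - i) * b ^ i) \<le> real (Suc n) * (a ^ n + b ^ n) / 2"
proof -
  have "(\<Sum>i<Suc n. a ^ (n - i) * b ^ i) = (\<Sum>i<Suc n. a ^ i * b ^ (n - i))"
    by (rule sum.reindex_bij_witness[of _ "\<lambda>i. n - i" "\<lambda>i. n - i"]) auto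
  then have "2 * (\<Sum>i<Suc n. a ^ (n - i) * b ^ i)
      = (\<Sum>i<Suc n. a ^ (n - i) * b ^ i + a ^ i * b ^ (n - i))"
    by (simp only: sum.distrib)
  also have "\<dots> \<le> (\<Sum>i<Suc n. a ^ n + b ^ n)"
  proof (rule sum_mono)
    fix i assume "i \<in> {..<Suc n}"
    then have i: "n = i + (n - i)" by simp
    have "0 \<le> (a ^ i - b ^ i) * (a ^ (n - i) - b ^ (n - i))"
    proof (cases "a \<le> b")
      case True
      then show ?thesis using assms by (intro mult_nonpos_nonpos) (auto intro: power_mono)
    next
      case False
      then show ?thesis using assms by (intro mult_nonneg_nonneg) (auto intro: power_mono)
    qed
    then show "a ^ (n - i) * b ^ i + a ^ i * b ^ (n - i) \<le> a ^ n + b ^ n"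
      by (subst (1 2) i) (simp add: power_add algebra_simps)
  qed
  also have "\<dots> = real (Suc n) * (a ^ n + b ^ n)" by simp
  finally show ?thesis by simp
qed

lemma selfadj_funpow_inner:
  assumes "onb C" "linear B" "\<And>c. c \<in> C \<Longrightarrow> B c = r c *\<^sub>R c"
  shows "(B ^^ i) y \<bullet> y = (\<Sum>d\<in>C. r d ^ i * (y \<bullet> d)\<^sup>2)"
proof -
  have "(B ^^ i) y \<bullet> y = (\<Sum>d\<in>C. (y \<bullet> d) * ((B ^^ i) d \<bullet> y))"
    by (rule onb_linear[OF assms(1) linear_funpow[OF assms(2)]])
  also have "\<dots> = (\<Sum>d\<in>C. r d ^ i * (y \<bullet> d)\<^sup>2)"
    by (intro sum.cong refl)
      (simp add: funpow_eigen[OF assms(2) assms(3)] power2_eq_square inner_commute mult_ac)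
  finally show ?thesis .
qed

lemma rtrace_funpow:
  assumes "onb C" "linear B" "\<And>c. c \<in> C \<Longrightarrow> B c = r c *\<^sub>R c"
  shows "rtrace (B ^^ i) = (\<Sum>c\<in>C. r c ^ i)"
proof -
  have "rtrace (B ^^ i) = (\<Sum>c\<in>C. (B ^^ i) c \<bullet> c)"
    by (rule rtrace_onb[OF assms(1) linear_funpow[OF assms(2)]])
  also have "\<dots> = (\<Sum>c\<in>C. r c ^ i)"
    using assms(1)
    by (intro sum.cong refl) (simp add: funpow_eigen[OF assms(2) assms(3)] onb_def norm_eq_1)
  finally show ?thesis .
qed

text \<open>The left-hand side is, up to the factor \<open>n + 2\<close>, the second derivative of \<open>tr (B + s Y)\<^bsup>n+2\<^esup>\<close>
  at \<open>s = 0\<close>.  In an eigenbasis of \<open>B\<close> it becomes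
  \<open>\<Sum> r\<^sub>c\<^bsup>n-i\<^esup> r\<^sub>d\<^sup>i (Y c \<bullet> d)\<^sup>2\<close> over \<open>c\<close>, \<open>d\<close> and \<open>i\<close>; by symmetry of \<open>(Y c \<bullet> d)\<^sup>2\<close> the mixed powers may be replaced
  by \<open>r\<^sub>c\<^sup>n\<close>, as if \<open>B\<close> and \<open>Y\<close> commuted.  The lower bound \<open>\<beta>\<close> on the spectrum restores the two
  missing powers of \<open>r\<^sub>c\<close>.\<close>
lemma rtrace_second_order_bound:
  fixes B Y :: "'h::euclidean_space \<Rightarrow> 'h"
  assumes B: "selfadj B" and Y: "selfadj Y" and \<beta>: "\<beta> > 0"
    and pos: "\<And>x. \<beta> * (norm x)\<^sup>2 \<le> B x \<bullet> x" and bd: "\<And>x. norm (Y x) \<le> R * norm x"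
  shows "(\<Sum>i<Suc n. rtrace (\<lambda>x. Y ((B ^^ i) (Y ((B ^^ (n - i)) x)))))
      \<le> real (Suc n) * (R / \<beta>)\<^sup>2 * rtrace (B ^^ (n + 2))"
proof -
  have lB: "linear B" and lY: "linear Y" and saY: "\<And>x y. Y x \<bullet> y = x \<bullet> Y y"
    using B Y by (auto simp: selfadj_def)
  obtain C r where C: "onb C" and r: "\<And>c. c \<in> C \<Longrightarrow> B c = r c *\<^sub>R c"
    using selfadj_eigenbasis[OF B] by blast
  have c1: "c \<bullet> c = 1" "norm c = 1" if "c \<in> C" for c
    using C that by (auto simp: onb_def norm_eq_1)
  have r\<beta>: "\<beta> \<le> r c" if "c \<in> C" for c
    using pos[of c] that by (simp add: r c1)
  have r0: "0 \<le> r c" if "c \<in> C" for c using r\<beta>[OF that] \<beta> by simp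
  define y where "y c d = (Y c \<bullet> d)\<^sup>2" for c d
  have ysym: "y c d = y d c" for c d unfolding y_def using saY[of c d] by (simp add: inner_commute)
  have ysum: "(\<Sum>d\<in>C. y c d) = (norm (Y c))\<^sup>2" for c
    unfolding y_def power2_norm_eq_inner
    by (simp only: power2_eq_square onb_inner[OF C, of "Y c" "Y c"])
  have t: "rtrace (\<lambda>x. Y ((B ^^ i) (Y ((B ^^ j) x)))) = (\<Sum>c\<in>C. \<Sum>d\<in>C. r c ^ j * r d ^ i * y c d)" for i j
  proof -
    have "linear (\<lambda>x. Y ((B ^^ i) (Y ((B ^^ j) x))))"
      using linear_compose[OF linear_compose[OF linear_compose[OF linear_funpow[OF lB, of j] lY]
          linear_funpow[OF lB, of i]] lY] by (simp add: o_def)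
    then have "rtrace (\<lambda>x. Y ((B ^^ i) (Y ((B ^^ j) x)))) = (\<Sum>c\<in>C. Y ((B ^^ i) (Y ((B ^^ j) c))) \<bullet> c)"
      by (rule rtrace_onb[OF C])
    also have "\<dots> = (\<Sum>c\<in>C. r c ^ j * ((B ^^ i) (Y c) \<bullet> Y c))"
      by (intro sum.cong refl)
        (simp add: saY funpow_eigen[OF lB r] linear_scale[OF lY] linear_scale[OF linear_funpow[OF lB]])
    also have "\<dots> = (\<Sum>c\<in>C. \<Sum>d\<in>C. r c ^ j * r d ^ i * y c d)"
      by (intro sum.cong refl)
        (simp add: selfadj_funpow_inner[OF C lB r] sum_distrib_left y_def mult_ac)
    finally show ?thesis .
  qed
  have "(\<Sum>i<Suc n. rtrace (\<lambda>x. Y ((B ^^ i) (Y ((B ^^ (n - i)) x)))))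
      = (\<Sum>c\<in>C. \<Sum>d\<in>C. (\<Sum>i<Suc n. r c ^ (n - i) * r d ^ i) * y c d)"
    unfolding t by (subst sum.swap, intro sum.cong refl, subst sum.swap)
      (simp only: sum_distrib_right)
  also have "\<dots> \<le> (\<Sum>c\<in>C. \<Sum>d\<in>C. (real (Suc n) * (r c ^ n + r d ^ n) / 2) * y c d)"
    by (intro sum_mono mult_right_mono power_mix_sum_le r0) (auto simp: y_def)
  also have "\<dots> = real (Suc n) / 2 * ((\<Sum>c\<in>C. \<Sum>d\<in>C. r c ^ n * y c d) + (\<Sum>c\<in>C. \<Sum>d\<in>C. r d ^ n * y c d))"
    by (simp add: sum_distrib_left sum.distrib[symmetric] algebra_simps add_divide_distrib)
  also have "(\<Sum>c\<in>C. \<Sum>d\<in>C. r d ^ n * y c d) = (\<Sum>c\<in>C. \<Sum>d\<in>C. r c ^ n * y c d)"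
    by (subst sum.swap) (simp add: ysym)
  also have "(\<Sum>c\<in>C. \<Sum>d\<in>C. r c ^ n * y c d) = (\<Sum>c\<in>C. r c ^ n * (norm (Y c))\<^sup>2)"
    by (simp add: sum_distrib_left[symmetric] ysum)
  also have "real (Suc n) / 2 * ((\<Sum>c\<in>C. r c ^ n * (norm (Y c))\<^sup>2) + (\<Sum>c\<in>C. r c ^ n * (norm (Y c))\<^sup>2))
      = real (Suc n) * (\<Sum>c\<in>C. r c ^ n * (norm (Y c))\<^sup>2)" by simp
  also have "\<dots> \<le> real (Suc n) * (\<Sum>c\<in>C. (R / \<beta>)\<^sup>2 * r c ^ (n + 2))"
  proof (intro mult_left_mono sum_mono)
    fix c assume c: "c \<in> C"
    have "(norm (Y c))\<^sup>2 \<le> R\<^sup>2" using bd[of c] c1[OF c] by (intro power_mono) auto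
    moreover have "\<beta>\<^sup>2 \<le> (r c)\<^sup>2" using r\<beta>[OF c] \<beta> by (intro power_mono) auto
    then have "1 \<le> (r c)\<^sup>2 / \<beta>\<^sup>2" using \<beta> by simp
    ultimately have "(norm (Y c))\<^sup>2 \<le> R\<^sup>2 * ((r c)\<^sup>2 / \<beta>\<^sup>2)"
      by (smt (verit) mult_left_mono mult_cancel_left1 zero_le_power2)
    then have "r c ^ n * (norm (Y c))\<^sup>2 \<le> r c ^ n * (R\<^sup>2 * ((r c)\<^sup>2 / \<beta>\<^sup>2))"
      by (intro mult_left_mono zero_le_power r0[OF c])
    then show "r c ^ n * (norm (Y c))\<^sup>2 \<le> (R / \<beta>)\<^sup>2 * r c ^ (n + 2)"
      by (simp add: power_add power_divide power2_eq_square mult_ac)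
  qed simp
  also have "\<dots> = real (Suc n) * (R / \<beta>)\<^sup>2 * rtrace (B ^^ (n + 2))"
    by (simp only: rtrace_funpow[OF C lB r] sum_distrib_left mult.assoc)
  finally show ?thesis .
qed

text \<open>The noncommutative product rule, evaluated at a fixed vector.\<close>
lemma has_vector_derivative_funpow:
  fixes A Y :: "'h::euclidean_space \<Rightarrow> 'h"
  assumes A: "linear A" and Y: "linear Y"
  defines "B \<equiv> \<lambda>s x. A x + s *\<^sub>R Y x"
  shows "((\<lambda>s. (B s ^^ k) x) has_vector_derivative
           (\<Sum>i<k. (B s ^^ i) (Y ((B s ^^ (k - 1 - i)) x)))) (at s)"
proof (induction k)
  case 0
  then show ?case by simp
next
  case (Suc k)
  let ?d = "\<Sum>i<k. (B s ^^ i) (Y ((B s ^^ (k - 1 - i)) x))"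
  have bA: "bounded_linear A" and bY: "bounded_linear Y"
    using A Y by (simp_all add: linear_conv_bounded_linear)
  have "((\<lambda>s. A ((B s ^^ k) x) + s *\<^sub>R Y ((B s ^^ k) x)) has_vector_derivative
      A ?d + (s *\<^sub>R Y ?d + 1 *\<^sub>R Y ((B s ^^ k) x))) (at s)"
    by (intro has_vector_derivative_add has_vector_derivative_scaleR
        bounded_linear.has_vector_derivative[OF bA Suc] bounded_linear.has_vector_derivative[OF bY Suc]
        DERIV_ident)
  moreover have "A ?d + (s *\<^sub>R Y ?d + 1 *\<^sub>R Y ((B s ^^ k) x))
      = (\<Sum>i<Suc k. (B s ^^ i) (Y ((B s ^^ (Suc k - 1 - i)) x)))"
  proof -
    have lB: "linear (B s)" unfolding B_def using A Y
      by (intro linear_compose_add linear_compose_scale_right)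
    have "(\<Sum>i<Suc k. (B s ^^ i) (Y ((B s ^^ (Suc k - 1 - i)) x)))
        = Y ((B s ^^ k) x) + (\<Sum>i<k. B s ((B s ^^ i) (Y ((B s ^^ (k - 1 - i)) x))))"
      by (subst sum.lessThan_Suc_shift) simp
    also have "\<dots> = Y ((B s ^^ k) x) + B s ?d" by (simp add: linear_sum[OF lB])
    finally show ?thesis by (simp add: B_def)
  qed
  ultimately show ?case by (simp add: B_def)
qed

text \<open>This takes the place of the inequality \<open>tr exp (A + Y) \<le> cosh R tr exp A + (sinh R / R) tr (Y exp A)\<close>
  for \<open>|Y| \<le> R\<close>.  The correction term is linear in \<open>Y\<close>, so it disappears on average when \<open>Y\<close> is a
  martingale increment.\<close>
lemma rtrace_power_cosh:
  fixes A Y :: "'h::euclidean_space \<Rightarrow> 'h" and n :: nat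
  assumes A: "selfadj A" and Y: "selfadj Y" and "\<beta> > 0" "R > 0"
    and pos: "\<And>x. \<beta> * (norm x)\<^sup>2 \<le> A x \<bullet> x" "\<And>x. \<beta> * (norm x)\<^sup>2 \<le> (A x + Y x) \<bullet> x"
    and bd: "\<And>x. norm (Y x) \<le> R * norm x"
  defines "N \<equiv> n + 2"
  defines "\<rho> \<equiv> real N * R / \<beta>"
  shows "rtrace ((\<lambda>x. A x + Y x) ^^ N)
     \<le> cosh \<rho> * rtrace (A ^^ N) + sinh \<rho> / \<rho> * (real N * rtrace (\<lambda>x. Y ((A ^^ (N - 1)) x)))"
proof -
  have lA: "linear A" and lY: "linear Y" using A Y by (auto simp: selfadj_def)
  define B where "B = (\<lambda>s x. A x + s *\<^sub>R Y x)"
  have lB: "linear (B s)" for s unfolding B_def using lA lY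
    by (intro linear_compose_add linear_compose_scale_right)
  have saB: "selfadj (B s)" for s
    using lB[of s] A Y by (simp add: selfadj_def B_def inner_add_left inner_add_right)
  have posB: "\<beta> * (norm x)\<^sup>2 \<le> B s x \<bullet> x" if "0 \<le> s" "s \<le> 1" for s x
  proof -
    have "(1 - s) * (\<beta> * (norm x)\<^sup>2) + s * (\<beta> * (norm x)\<^sup>2)
        \<le> (1 - s) * (A x \<bullet> x) + s * ((A x + Y x) \<bullet> x)"
      using that pos by (intro add_mono mult_left_mono) auto
    then show ?thesis by (simp add: B_def inner_add_left algebra_simps)
  qed
  have D: "((\<lambda>s. (B s ^^ k) x) has_vector_derivative
      (\<Sum>i<k. (B s ^^ i) (Y ((B s ^^ (k - 1 - i)) x)))) (at s)" for k x s
    unfolding B_def by (rule has_vector_derivative_funpow[OF lA lY])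
  have lin_B: "linear (\<lambda>x. (B s ^^ i) (Y ((B s ^^ j) x)))" for s i j
    using linear_compose[OF linear_compose[OF linear_funpow[OF lB, of j s] lY] linear_funpow[OF lB, of i s]]
    by (simp add: o_def)
  have D0: "((\<lambda>s. rtrace (B s ^^ N)) has_real_derivative
      real N * rtrace (\<lambda>x. Y ((B s ^^ (N - 1)) x))) (at s)" for s
  proof -
    have "((\<lambda>s. rtrace (B s ^^ N)) has_real_derivative
        (\<Sum>b\<in>Basis. (\<Sum>i<N. (B s ^^ i) (Y ((B s ^^ (N - 1 - i)) b))) \<bullet> b)) (at s)"
      unfolding rtrace_def has_real_derivative_iff_has_vector_derivative
      by (intro has_vector_derivative_sum bounded_linear.has_vector_derivative[OF bounded_linear_inner_left] D)
    moreover have "(\<Sum>b\<in>Basis. (\<Sum>i<N. (B s ^^ i) (Y ((B s ^^ (N - 1 - i)) b))) \<bullet> b)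
        = (\<Sum>i<N. rtrace (\<lambda>x. (B s ^^ i) (Y ((B s ^^ (N - 1 - i)) x))))"
      unfolding rtrace_def inner_sum_left by (rule sum.swap)
    also have "\<dots> = (\<Sum>i<N. rtrace (\<lambda>x. Y ((B s ^^ (N - 1)) x)))"
    proof (intro sum.cong refl)
      fix i assume "i \<in> {..<N}"
      then have i: "N - 1 = N - 1 - i + i" by simp
      have "linear (\<lambda>x. Y ((B s ^^ (N - 1 - i)) x))"
        using linear_compose[OF linear_funpow[OF lB, of "N - 1 - i" s] lY] by (simp add: o_def)
      from rtrace_cyclic[OF linear_funpow[OF lB, of i s] this]
      have "rtrace (\<lambda>x. (B s ^^ i) (Y ((B s ^^ (N - 1 - i)) x)))
          = rtrace (\<lambda>x. Y ((B s ^^ (N - 1 - i)) ((B s ^^ i) x)))" .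
      also have "\<dots> = rtrace (\<lambda>x. Y ((B s ^^ (N - 1)) x))"
        by (subst (2) i) (simp only: funpow_add o_apply)
      finally show "rtrace (\<lambda>x. (B s ^^ i) (Y ((B s ^^ (N - 1 - i)) x)))
          = rtrace (\<lambda>x. Y ((B s ^^ (N - 1)) x))" .
    qed
    ultimately show ?thesis by simp
  qed
  have D1: "((\<lambda>s. real N * rtrace (\<lambda>x. Y ((B s ^^ (N - 1)) x))) has_real_derivative
      real N * (\<Sum>i<Suc n. rtrace (\<lambda>x. Y ((B s ^^ i) (Y ((B s ^^ (n - i)) x)))))) (at s)" for s
  proof -
    have bY: "bounded_linear Y" using lY by (simp add: linear_conv_bounded_linear)
    have "((\<lambda>s. rtrace (\<lambda>x. Y ((B s ^^ (N - 1)) x))) has_real_derivative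
        (\<Sum>b\<in>Basis. Y (\<Sum>i<N - 1. (B s ^^ i) (Y ((B s ^^ (N - 1 - 1 - i)) b))) \<bullet> b)) (at s)"
      unfolding rtrace_def has_real_derivative_iff_has_vector_derivative
      by (intro has_vector_derivative_sum bounded_linear.has_vector_derivative[OF bounded_linear_inner_left]
          bounded_linear.has_vector_derivative[OF bY] D)
    also have "(\<Sum>b\<in>Basis. Y (\<Sum>i<N - 1. (B s ^^ i) (Y ((B s ^^ (N - 1 - 1 - i)) b))) \<bullet> b)
        = (\<Sum>i<Suc n. rtrace (\<lambda>x. Y ((B s ^^ i) (Y ((B s ^^ (n - i)) x)))))"
      unfolding rtrace_def linear_sum[OF lY] inner_sum_left
      by (subst sum.swap) (simp add: N_def)
    finally show ?thesis by (rule DERIV_cmult)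
  qed
  have "rtrace (B 1 ^^ N) \<le> cosh \<rho> * rtrace (B 0 ^^ N)
      + sinh \<rho> / \<rho> * (real N * rtrace (\<lambda>x. Y ((B 0 ^^ (N - 1)) x)))"
  proof (rule cosh_comparison[OF _ D0 D1])
    show "\<rho> > 0" unfolding \<rho>_def N_def using \<open>\<beta> > 0\<close> \<open>R > 0\<close> by simp
    fix s :: real assume s: "0 \<le> s" "s \<le> 1"
    obtain C r where C: "onb C" and r: "\<And>c. c \<in> C \<Longrightarrow> B s c = r c *\<^sub>R c"
      using selfadj_eigenbasis[OF saB] by blast
    have "0 \<le> r c" if "c \<in> C" for c
    proof -
      have "norm c = 1" "c \<bullet> c = 1" using C that by (auto simp: onb_def norm_eq_1)
      then show ?thesis using posB[OF s, of c] that \<open>\<beta> > 0\<close> by (simp add: r)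
    qed
    then have tr0: "0 \<le> rtrace (B s ^^ N)"
      by (simp add: rtrace_funpow[OF C lB r] sum_nonneg)
    have "real N * (\<Sum>i<Suc n. rtrace (\<lambda>x. Y ((B s ^^ i) (Y ((B s ^^ (n - i)) x)))))
       \<le> real N * (real (Suc n) * (R / \<beta>)\<^sup>2 * rtrace (B s ^^ (n + 2)))"
      using rtrace_second_order_bound[OF saB Y \<open>\<beta> > 0\<close> posB[OF s] bd, of n]
      by (intro mult_left_mono) auto
    also have "\<dots> = (real N * real (Suc n)) * ((R / \<beta>)\<^sup>2 * rtrace (B s ^^ N))"
      by (simp add: N_def)
    also have "\<dots> \<le> (real N * real N) * ((R / \<beta>)\<^sup>2 * rtrace (B s ^^ N))"
      using tr0 by (intro mult_right_mono mult_left_mono) (auto simp: N_def)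
    also have "\<dots> = \<rho>\<^sup>2 * rtrace (B s ^^ N)"
      by (simp add: \<rho>_def power2_eq_square)
    finally show "real N * (\<Sum>i<Suc n. rtrace (\<lambda>x. Y ((B s ^^ i) (Y ((B s ^^ (n - i)) x)))))
       \<le> \<rho>\<^sup>2 * rtrace (B s ^^ N)" .
  qed
  then show ?thesis by (simp add: B_def)
qed

section \<open>Hermitian matrices as real operators\<close>

lemma bounded_bilinear_matrix_vector:
  "bounded_bilinear (\<lambda>(A::complex^'n::finite^'m::finite) v. A *v v)"
proof -
  have "linear (\<lambda>A::complex^'n^'m. A *v v)" for v
  proof (rule linearI)
    show "(A + B) *v v = A *v v + B *v v" for A B :: "complex^'n^'m"
      by (rule matrix_vector_mult_add_rdistrib)
    show "(r *\<^sub>R A) *v v = r *\<^sub>R (A *v v)" for r and A :: "complex^'n^'m"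
      by (simp add: vec_eq_iff matrix_vector_mult_def scaleR_sum_right)
  qed
  then have "bilinear (\<lambda>(A::complex^'n::finite^'m::finite) v. A *v v)"
    unfolding bilinear_def using matrix_vector_mul_linear by blast
  then show ?thesis by (simp add: bilinear_conv_bounded_bilinear)
qed

interpretation matrix_vector: bounded_bilinear "\<lambda>(A::complex^'n::finite^'m::finite) v. A *v v"
  by (rule bounded_bilinear_matrix_vector)

lemma linear_matrix_vector: "linear (\<lambda>v. (A::complex^'n::finite^'m::finite) *v v)"
  by (rule bounded_linear.linear[OF matrix_vector.bounded_linear_right])

lemma hermitian_selfadj:
  assumes "hermitian (A::complex^'m::finite^'m)"
  shows "selfadj (\<lambda>v. A *v v)"
  unfolding selfadj_def
proof (intro conjI allI linear_matrix_vector)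
  fix x y :: "complex^'m"
  have A: "A $ i $ j = cnj (A $ j $ i)" for i j using assms unfolding hermitian_def by blast
  have 1: "(A *v x) \<bullet> y = (\<Sum>i\<in>UNIV. \<Sum>j\<in>UNIV. (A $ i $ j * x $ j) \<bullet> y $ i)"
    by (simp add: inner_vec_def matrix_vector_mult_def inner_sum_left)
  have 2: "x \<bullet> (A *v y) = (\<Sum>j\<in>UNIV. \<Sum>i\<in>UNIV. x $ j \<bullet> (A $ j $ i * y $ i))"
    by (simp add: inner_vec_def matrix_vector_mult_def inner_sum_right)
  have 3: "(A $ i $ j * x $ j) \<bullet> y $ i = x $ j \<bullet> (A $ j $ i * y $ i)" for i j
    unfolding A[of i j] by (simp add: inner_complex_def algebra_simps)
  have "(A *v x) \<bullet> y = (\<Sum>j\<in>UNIV. \<Sum>i\<in>UNIV. (A $ i $ j * x $ j) \<bullet> y $ i)"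
    unfolding 1 by (rule sum.swap)
  also have "\<dots> = x \<bullet> (A *v y)"
    unfolding 2 by (intro sum.cong refl 3)
  finally show "(A *v x) \<bullet> y = x \<bullet> (A *v y)" .
qed

lemma hermitian_combine:
  assumes "hermitian A" "hermitian B"
  shows "hermitian (A + B)" "hermitian (A - B)" "hermitian (c *\<^sub>R A)"
  using assms unfolding hermitian_def
  by (metis complex_cnj_add vector_add_component, metis complex_cnj_diff vector_minus_component,
      metis complex_cnj_scaleR vector_scaleR_component)

lemma scaleR_eq_vector_scalar: "complex_of_real r *s v = r *\<^sub>R (v::complex^'m::finite)"
  by (simp add: vec_eq_iff scaleR_conv_of_real[where 'a=complex])

text \<open>The maximum in the definition of \<^const>\<open>lambda_max\<close> is attained because an orthonormal
  eigenbasis shows that the set of real eigenvalues is finite and nonempty.\<close>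
lemma is_eigenvalue_lambda_max:
  fixes A :: "complex^'m::finite^'m"
  assumes "hermitian A"
  shows "is_eigenvalue A (complex_of_real (lambda_max A))"
proof -
  obtain C r where C: "onb C" and r: "\<And>c. c \<in> C \<Longrightarrow> A *v c = r c *\<^sub>R c"
    using selfadj_eigenbasis[OF hermitian_selfadj[OF assms]] by blast
  have sa: "(A *v x) \<bullet> y = x \<bullet> (A *v y)" for x y
    using hermitian_selfadj[OF assms] by (simp add: selfadj_def)
  let ?E = "{s. is_eigenvalue A (complex_of_real s)}"
  have "?E \<subseteq> r ` C"
  proof
    fix s assume "s \<in> ?E"
    then obtain v where v: "v \<noteq> 0" "A *v v = s *\<^sub>R v"
      by (auto simp: is_eigenvalue_def scaleR_eq_vector_scalar)
    obtain c where c: "c \<in> C" "v \<bullet> c \<noteq> 0"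
      using onb_expand[OF C, of v] v(1) by (metis (mono_tags, lifting) scaleR_zero_left sum.neutral)
    have "s * (v \<bullet> c) = r c * (v \<bullet> c)"
      using sa[of v c] v(2) r[OF c(1)] by simp
    with c show "s \<in> r ` C" by auto
  qed
  then have "finite ?E" using onb_finite[OF C] finite_surj by blast
  moreover have "?E \<noteq> {}"
  proof -
    have "C \<noteq> {}"
    proof
      assume "C = {}"
      then have "UNIV = {0 :: complex^'m}" using C by (simp add: onb_def)
      then have "axis undefined 1 = (0 :: complex^'m)" by blast
      then show False by (simp add: axis_eq_0_iff)
    qed
    then obtain c where c: "c \<in> C" by blast
    then have "c \<noteq> 0" using C by (auto simp: onb_def)
    with r[OF c] have "r c \<in> ?E"
      by (auto simp: is_eigenvalue_def scaleR_eq_vector_scalar)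
    then show ?thesis by blast
  qed
  ultimately have "Max ?E \<in> ?E" by (rule Max_in)
  then show ?thesis by (simp add: lambda_max_def)
qed

text \<open>By Bessel's inequality an orthonormal pair puts weight at most 1 on each vector of an
  eigenbasis.\<close>
lemma rtrace_power_ge_pair:
  fixes B :: "'h::euclidean_space \<Rightarrow> 'h"
  assumes B: "selfadj B" and pos: "\<And>x. 0 \<le> B x \<bullet> x"
    and vw: "norm v = 1" "norm w = 1" "v \<bullet> w = 0" and e: "B v = \<mu> *\<^sub>R v" "B w = \<mu> *\<^sub>R w"
  shows "2 * \<mu> ^ N \<le> rtrace (B ^^ N)"
proof -
  have lB: "linear B" using B by (simp add: selfadj_def)
  obtain C r where C: "onb C" and r: "\<And>c. c \<in> C \<Longrightarrow> B c = r c *\<^sub>R c"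
    using selfadj_eigenbasis[OF B] by blast
  have bessel: "(v \<bullet> c)\<^sup>2 + (w \<bullet> c)\<^sup>2 \<le> 1" if "c \<in> C" for c
  proof -
    have cc: "c \<bullet> c = 1" using C that by (auto simp: onb_def norm_eq_1)
    have "0 \<le> (c - (v \<bullet> c) *\<^sub>R v - (w \<bullet> c) *\<^sub>R w) \<bullet> (c - (v \<bullet> c) *\<^sub>R v - (w \<bullet> c) *\<^sub>R w)"
      by (rule inner_ge_zero)
    also have "\<dots> = 1 - (v \<bullet> c)\<^sup>2 - (w \<bullet> c)\<^sup>2"
      using vw cc by (simp add: inner_diff_left inner_diff_right norm_eq_1 power2_eq_square
          inner_commute[of c v] inner_commute[of c w] inner_commute[of w v])
    finally show ?thesis by simp
  qed
  have r0: "0 \<le> r c" if "c \<in> C" for c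
    using pos[of c] that C by (simp add: r onb_def norm_eq_1)
  have "2 * \<mu> ^ N = (B ^^ N) v \<bullet> v + (B ^^ N) w \<bullet> w"
    using vw by (simp add: funpow_eigen[OF lB e(1)] funpow_eigen[OF lB e(2)] norm_eq_1)
  also have "\<dots> = (\<Sum>c\<in>C. r c ^ N * ((v \<bullet> c)\<^sup>2 + (w \<bullet> c)\<^sup>2))"
    by (simp add: selfadj_funpow_inner[OF C lB r] sum.distrib[symmetric] distrib_left)
  also have "\<dots> \<le> (\<Sum>c\<in>C. r c ^ N * 1)"
    by (intro sum_mono mult_left_mono bessel zero_le_power r0)
  also have "\<dots> = rtrace (B ^^ N)" by (simp add: rtrace_funpow[OF C lB r])
  finally show ?thesis .
qed

text \<open>The factor 2 matches the doubling of the trace: an eigenvector \<open>v\<close> and its multiple \<open>\<i> v\<close> are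
  orthogonal over the reals.\<close>
lemma lambda_max_power_le_rtrace:
  fixes A :: "complex^'m::finite^'m" and a \<theta> :: real
  defines "B \<equiv> \<lambda>x. a *\<^sub>R x + \<theta> *\<^sub>R (A *v x)"
  assumes A: "hermitian A" and pos: "\<And>x. 0 \<le> B x \<bullet> x"
  shows "2 * (a + \<theta> * lambda_max A) ^ N \<le> rtrace (B ^^ N)"
proof -
  obtain v0 where v0: "v0 \<noteq> 0" "A *v v0 = complex_of_real (lambda_max A) *s v0"
    using is_eigenvalue_lambda_max[OF A] by (auto simp: is_eigenvalue_def)
  define v where "v = (1 / norm v0) *\<^sub>R v0"
  define w where "w = \<i> *s v"
  have lA: "linear (\<lambda>v. A *v v)" and sa: "\<And>x y. (A *v x) \<bullet> y = x \<bullet> (A *v y)"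
    using hermitian_selfadj[OF A] by (auto simp: selfadj_def)
  have ev: "A *v v = lambda_max A *\<^sub>R v"
    unfolding v_def using v0(2) by (simp add: linear_scale[OF lA] scaleR_eq_vector_scalar)
  have "A *v w = \<i> *s (A *v v)"
    unfolding w_def by (simp add: vector_scalar_commute)
  then have ew: "A *v w = lambda_max A *\<^sub>R w"
    unfolding ev w_def by (simp add: vec_eq_iff)
  have nv: "norm v = 1" using v0(1) by (simp add: v_def)
  have nw: "norm w = 1"
    using nv unfolding w_def norm_vec_def by (simp add: norm_mult)
  have vw: "v \<bullet> w = 0"
    unfolding w_def by (simp add: inner_vec_def inner_complex_def)
  have "selfadj B"
    unfolding selfadj_def B_def
    by (auto simp: inner_add_left inner_add_right sa
        intro!: linear_compose_add linear_compose_scale_right lA linear_ident)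
  from rtrace_power_ge_pair[OF this pos nv nw vw] show ?thesis
    by (simp add: B_def ev ew scaleR_add_left)
qed

lemma norm_matrix_le:
  fixes A :: "complex^'m::finite^'m"
  assumes "\<And>x. norm (A *v x) \<le> K * norm x"
  shows "norm A \<le> real CARD('m) * (real CARD('m) * K)"
proof -
  have e: "norm (A $ i $ j) \<le> K" for i j
  proof -
    have "A $ i $ j = (A *v axis j 1) $ i"
      by (simp add: matrix_vector_mult_def axis_def if_distrib cong: if_cong)
    then have "norm (A $ i $ j) \<le> norm (A *v axis j 1)" by (simp only: Finite_Cartesian_Product.norm_nth_le)
    also have "\<dots> \<le> K" 
    proof -
      have "norm (axis j 1 :: complex^'m) = 1" by (simp add: norm_eq_1 inner_axis_axis)
      then show ?thesis using assms[of "axis j 1"] by simp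
    qed
    finally show ?thesis .
  qed
  have "norm A \<le> (\<Sum>i\<in>UNIV. norm (A $ i))"
    unfolding norm_vec_def[of A] by (rule L2_set_le_sum) simp
  also have "\<dots> \<le> (\<Sum>i\<in>(UNIV::'m set). real CARD('m) * K)"
  proof (rule sum_mono)
    fix i
    have "norm (A $ i) \<le> (\<Sum>j\<in>UNIV. norm (A $ i $ j))"
      unfolding norm_vec_def[of "A $ i"] by (rule L2_set_le_sum) simp
    also have "\<dots> \<le> (\<Sum>j\<in>(UNIV::'m set). K)" by (intro sum_mono e)
    finally show "norm (A $ i) \<le> real CARD('m) * K" by simp
  qed
  finally show ?thesis by simp
qed

lemma continuous_on_matrix_power_apply:
  "continuous_on UNIV (\<lambda>A::complex^'m::finite^'m. ((\<lambda>x. a *\<^sub>R x + \<theta> *\<^sub>R (A *v x)) ^^ k) x)"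
  by (induction k) (auto intro!: continuous_intros matrix_vector.continuous_on)

section \<open>An Azuma inequality for Hermitian matrices\<close>

lemma (in prob_space) integrable_continuous_bounded:
  fixes A :: "'a \<Rightarrow> 'e::euclidean_space" and h :: "'e \<Rightarrow> 'f::{banach, second_countable_topology}"
  assumes "A \<in> borel_measurable M" "\<And>\<omega>. \<omega> \<in> space M \<Longrightarrow> norm (A \<omega>) \<le> K" "continuous_on UNIV h"
  shows "integrable M (\<lambda>\<omega>. h (A \<omega>))"
proof -
  have "compact (h ` cball 0 K)"
    using assms(3) by (intro compact_continuous_image) (auto intro: continuous_on_subset)
  then obtain c where c: "\<And>x. x \<in> cball 0 K \<Longrightarrow> norm (h x) \<le> c"
    using compact_imp_bounded bounded_iff by (metis image_eqI)
  show ?thesis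
  proof (rule integrable_const_bound)
    show "(\<lambda>\<omega>. h (A \<omega>)) \<in> borel_measurable M"
      using borel_measurable_continuous_onI[OF assms(3)] assms(1) by measurable
    show "AE \<omega> in M. norm (h (A \<omega>)) \<le> c"
      using c assms(2) by (auto intro!: AE_I2)
  qed
qed

text \<open>The martingale property is tested against continuous functions of the current value.  This is the
  martingale property for the filtration generated by the process itself, and it lets a
  deterministic starting point precede the first observation of the Markov chain.\<close>
locale matrix_martingale = prob_space M for M :: "'w measure" +
  fixes A :: "nat \<Rightarrow> 'w \<Rightarrow> complex^'m::finite^'m" and q :: nat and R :: real
  assumes measurable_A: "b \<le> q \<Longrightarrow> A b \<in> borel_measurable M"
    and hermitian_A: "b \<le> q \<Longrightarrow> \<omega> \<in> space M \<Longrightarrow> hermitian (A b \<omega>)"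
    and start: "\<omega> \<in> space M \<Longrightarrow> A 0 \<omega> = 0"
    and increment_le: "b < q \<Longrightarrow> \<omega> \<in> space M \<Longrightarrow> norm ((A (Suc b) \<omega> - A b \<omega>) *v x) \<le> R * norm x"
    and increment_mean: "b < q \<Longrightarrow> continuous_on UNIV \<zeta> \<Longrightarrow>
          (LINT \<omega>|M. (\<zeta> (A b \<omega>) :: real) *\<^sub>R (A (Suc b) \<omega> - A b \<omega>)) = 0"
    and R_pos: "R > 0"
begin

lemma norm_apply_le:
  assumes "b \<le> q" "\<omega> \<in> space M"
  shows "norm (A b \<omega> *v x) \<le> real b * R * norm x"
  using assms(1)
proof (induction b)
  case 0
  then show ?case using start[OF assms(2)] by simp
next
  case (Suc b)
  have "norm (A (Suc b) \<omega> *v x) = norm (A b \<omega> *v x + (A (Suc b) \<omega> - A b \<omega>) *v x)"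
    by (simp add: matrix_vector_mult_diff_rdistrib)
  also have "\<dots> \<le> real b * R * norm x + R * norm x"
    using Suc increment_le[of b \<omega> x] assms(2) by (intro norm_triangle_le add_mono) auto
  finally show ?case by (simp add: algebra_simps)
qed

lemma norm_apply_le_uniform:
  assumes "b \<le> q" "\<omega> \<in> space M"
  shows "norm (A b \<omega> *v x) \<le> real q * R * norm x"
  using norm_apply_le[OF assms, of x] assms(1) R_pos
  by (meson mult_right_mono norm_ge_zero of_nat_le_iff order_trans less_imp_le)

lemma integrable_continuous:
  fixes h :: "complex^'m^'m \<Rightarrow> 'f::{banach, second_countable_topology}"
  assumes "b \<le> q" "continuous_on UNIV h"
  shows "integrable M (\<lambda>\<omega>. h (A b \<omega>))"
  using assms norm_apply_le_uniform
  by (intro integrable_continuous_bounded[OF measurable_A _ assms(2)]) (auto intro: norm_matrix_le)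

text \<open>For \<open>a = N\<close> the \<open>N\<close>-th power, divided by \<open>N\<^sup>N\<close>, approximates the exponential of \<open>\<theta> H\<close>.\<close>
definition affine_op :: "real \<Rightarrow> real \<Rightarrow> complex^'m^'m \<Rightarrow> complex^'m \<Rightarrow> complex^'m" where
  "affine_op a \<theta> H x = a *\<^sub>R x + \<theta> *\<^sub>R (H *v x)"

lemma selfadj_affine_op: "hermitian H \<Longrightarrow> selfadj (affine_op a \<theta> H)"
  using hermitian_selfadj[of H] unfolding selfadj_def affine_op_def
  by (auto simp: inner_add_left inner_add_right intro!: linear_compose_add linear_compose_scale_right linear_ident)

lemma continuous_affine_power: "continuous_on UNIV (\<lambda>H. (affine_op a \<theta> H ^^ k) x)"
  unfolding affine_op_def[abs_def] by (rule continuous_on_matrix_power_apply)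

lemma continuous_rtrace_affine: "continuous_on UNIV (\<lambda>H. rtrace (affine_op a \<theta> H ^^ k))"
  unfolding rtrace_def by (intro continuous_intros continuous_affine_power)

lemma affine_op_pos:
  assumes "b \<le> q" "\<omega> \<in> space M" "\<theta> \<ge> 0"
  shows "(a - \<theta> * (real q * R)) * (norm x)\<^sup>2 \<le> affine_op a \<theta> (A b \<omega>) x \<bullet> x"
proof -
  have "\<bar>(A b \<omega> *v x) \<bullet> x\<bar> \<le> norm (A b \<omega> *v x) * norm x"
    by (rule Cauchy_Schwarz_ineq2)
  also have "\<dots> \<le> (real q * R * norm x) * norm x"
    by (intro mult_right_mono norm_apply_le_uniform assms) simp
  finally have "- (real q * R * (norm x)\<^sup>2) \<le> (A b \<omega> *v x) \<bullet> x" by (simp add: power2_eq_square)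
  then have "\<theta> * - (real q * R * (norm x)\<^sup>2) \<le> \<theta> * ((A b \<omega> *v x) \<bullet> x)"
    using assms(3) by (rule mult_left_mono)
  then show ?thesis
    by (simp add: affine_op_def inner_add_left power2_norm_eq_inner algebra_simps)
qed

text \<open>The trace is a sum of entries of the increment multiplied by continuous functions of the current
  value.\<close>
lemma expectation_linear_term:
  assumes b: "b < q"
  shows "integrable M (\<lambda>\<omega>. rtrace (\<lambda>x. (A (Suc b) \<omega> - A b \<omega>) *v ((affine_op a \<theta> (A b \<omega>) ^^ k) x)))" (is "integrable M ?f")
    and "(LINT \<omega>|M. rtrace (\<lambda>x. (A (Suc b) \<omega> - A b \<omega>) *v ((affine_op a \<theta> (A b \<omega>) ^^ k) x))) = 0"
proof -
  let ?Y = "\<lambda>\<omega>. A (Suc b) \<omega> - A b \<omega>"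
  let ?z = "\<lambda>c d \<omega>. (affine_op a \<theta> (A b \<omega>) ^^ k) c \<bullet> d"
  have expand: "?f \<omega> = (\<Sum>c\<in>Basis. \<Sum>d\<in>Basis. ((?z c d \<omega> *\<^sub>R ?Y \<omega>) *v d) \<bullet> c)" for \<omega>
  proof -
    have "(?Y \<omega> *v y) \<bullet> c = (\<Sum>d\<in>Basis. (y \<bullet> d) * ((?Y \<omega> *v d) \<bullet> c))" for y c
      by (rule onb_linear[OF onb_Basis linear_matrix_vector])
    then show ?thesis
      unfolding rtrace_def matrix_vector.scaleR_left inner_scaleR_left
      by (intro sum.cong refl)
  qed
  have cont: "continuous_on UNIV (\<lambda>H. (affine_op a \<theta> H ^^ k) c \<bullet> d)" for c d
    by (intro continuous_intros continuous_affine_power)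
  have int: "integrable M (\<lambda>\<omega>. ?z c d \<omega> *\<^sub>R ?Y \<omega>)" for c d
  proof -
    have "integrable M (\<lambda>\<omega>. ?z c d \<omega> *\<^sub>R A b \<omega>)"
      using b by (intro integrable_continuous[of b "\<lambda>H. ((affine_op a \<theta> H ^^ k) c \<bullet> d) *\<^sub>R H"] continuous_intros cont) auto
    moreover have "integrable M (\<lambda>\<omega>. ?z c d \<omega> *\<^sub>R A (Suc b) \<omega>)"
    proof -
      let ?P = "\<lambda>\<omega>. (A b \<omega>, A (Suc b) \<omega>)"
      let ?h = "\<lambda>(H, G). ((affine_op a \<theta> H ^^ k) c \<bullet> d) *\<^sub>R (G :: complex^'m^'m)"
      have "integrable M (\<lambda>\<omega>. ?h (?P \<omega>))"
      proof (rule integrable_continuous_bounded[of ?P _ ?h])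
        show "?P \<in> borel_measurable M"
          using measurable_A[of b] measurable_A[of "Suc b"] b by simp
        show "norm (?P \<omega>) \<le> real CARD('m) * (real CARD('m) * (real q * R)) + real CARD('m) * (real CARD('m) * (real q * R))"
          if "\<omega> \<in> space M" for \<omega>
          using b that norm_apply_le_uniform
          by (intro order_trans[OF norm_Pair_le] add_mono norm_matrix_le) auto
        show "continuous_on UNIV ?h"
          unfolding case_prod_unfold
          by (intro continuous_on_scaleR continuous_on_snd continuous_on_id
              continuous_on_compose2[OF cont continuous_on_fst]) auto
      qed
      then show ?thesis by simp
    qed
    ultimately show ?thesis by (simp add: scaleR_diff_right)
  qed
  have bl: "bounded_linear (\<lambda>H::complex^'m^'m. (H *v d) \<bullet> c)" for c d
    by (rule bounded_linear_compose[OF bounded_linear_inner_left matrix_vector.bounded_linear_left])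
  show "integrable M ?f"
    unfolding expand by (intro Bochner_Integration.integrable_sum integrable_bounded_linear[OF bl] int)
  have "(LINT \<omega>|M. ((?z c d \<omega> *\<^sub>R ?Y \<omega>) *v d) \<bullet> c) = 0" for c d
    using integral_bounded_linear[OF bl int, of c d d c] increment_mean[OF b cont, of c d] by simp
  then show "integral\<^sup>L M ?f = 0"
    unfolding expand
    by (subst Bochner_Integration.integral_sum;
        (intro Bochner_Integration.integrable_sum integrable_bounded_linear[OF bl] int)?)
      (subst Bochner_Integration.integral_sum; (intro integrable_bounded_linear[OF bl] int)?; simp)
qed

text \<open>The constant \<open>\<rho>\<close> tends to \<open>\<theta> R\<close> as \<open>N \<rightarrow> \<infinity>\<close>: \<open>\<theta> q R\<close> bounds the norm of \<open>\<theta> A\<close> throughout, so the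
  operators \<open>N + \<theta> A\<close> are bounded below by \<open>N - \<theta> q R\<close>.\<close>
lemma expectation_step:
  assumes b: "b < q" and \<theta>: "\<theta> > 0" and \<beta>: "real (n + 2) - \<theta> * (real q * R) > 0"
  defines "N \<equiv> n + 2"
  defines "\<rho> \<equiv> real N * (\<theta> * R) / (real N - \<theta> * (real q * R))"
  shows "(LINT \<omega>|M. rtrace (affine_op (real N) \<theta> (A (Suc b) \<omega>) ^^ N))
     \<le> cosh \<rho> * (LINT \<omega>|M. rtrace (affine_op (real N) \<theta> (A b \<omega>) ^^ N))"
proof -
  let ?B = "\<lambda>b \<omega>. affine_op (real N) \<theta> (A b \<omega>)"
  let ?Y = "\<lambda>\<omega>. A (Suc b) \<omega> - A b \<omega>"
  let ?l = "\<lambda>\<omega>. rtrace (\<lambda>x. ?Y \<omega> *v ((?B b \<omega> ^^ (N - 1)) x))"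
  let ?c = "sinh \<rho> / \<rho> * (real N * \<theta>)"
  have "rtrace (?B (Suc b) \<omega> ^^ N) \<le> cosh \<rho> * rtrace (?B b \<omega> ^^ N) + ?c * ?l \<omega>" if \<omega>: "\<omega> \<in> space M" for \<omega>
  proof -
    have herm: "hermitian (A b \<omega>)" "hermitian (A (Suc b) \<omega>)" using hermitian_A b \<omega> by auto
    then have hY: "hermitian (\<theta> *\<^sub>R ?Y \<omega>)" by (intro hermitian_combine)
    have sum: "?B b \<omega> x + (\<theta> *\<^sub>R ?Y \<omega>) *v x = ?B (Suc b) \<omega> x" for x
      by (simp add: affine_op_def matrix_vector.scaleR_left matrix_vector_mult_diff_rdistrib algebra_simps)
    have "rtrace ((\<lambda>x. ?B b \<omega> x + (\<theta> *\<^sub>R ?Y \<omega>) *v x) ^^ (n + 2))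
      \<le> cosh (real (n + 2) * (\<theta> * R) / (real N - \<theta> * (real q * R))) * rtrace (?B b \<omega> ^^ (n + 2))
       + sinh (real (n + 2) * (\<theta> * R) / (real N - \<theta> * (real q * R))) / (real (n + 2) * (\<theta> * R) / (real N - \<theta> * (real q * R)))
          * (real (n + 2) * rtrace (\<lambda>x. (\<theta> *\<^sub>R ?Y \<omega>) *v ((?B b \<omega> ^^ (n + 2 - 1)) x)))"
    proof (rule rtrace_power_cosh[OF selfadj_affine_op[OF herm(1)] hermitian_selfadj[OF hY]])
      show "0 < real N - \<theta> * (real q * R)" using \<beta> by (simp add: N_def)
      show "0 < \<theta> * R" using \<theta> R_pos by simp
      show "(real N - \<theta> * (real q * R)) * (norm x)\<^sup>2 \<le> ?B b \<omega> x \<bullet> x" for x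
        using b \<omega> \<theta> by (intro affine_op_pos) auto
      show "(real N - \<theta> * (real q * R)) * (norm x)\<^sup>2 \<le> (?B b \<omega> x + (\<theta> *\<^sub>R ?Y \<omega>) *v x) \<bullet> x" for x
        unfolding sum using b \<omega> \<theta> by (intro affine_op_pos) auto
      show "norm ((\<theta> *\<^sub>R ?Y \<omega>) *v x) \<le> \<theta> * R * norm x" for x
        using increment_le[OF b \<omega>, of x] \<theta> by (simp add: matrix_vector.scaleR_left)
    qed
    moreover have "rtrace (\<lambda>x. (\<theta> *\<^sub>R ?Y \<omega>) *v ((?B b \<omega> ^^ (n + 2 - 1)) x)) = \<theta> * ?l \<omega>"
      by (simp add: rtrace_def matrix_vector.scaleR_left sum_distrib_left N_def)
    moreover have "(\<lambda>x. ?B b \<omega> x + (\<theta> *\<^sub>R ?Y \<omega>) *v x) = ?B (Suc b) \<omega>" using sum by (intro ext)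
    ultimately show ?thesis by (simp only: \<rho>_def N_def mult.assoc)
  qed
  then have "(LINT \<omega>|M. rtrace (?B (Suc b) \<omega> ^^ N)) \<le> (LINT \<omega>|M. cosh \<rho> * rtrace (?B b \<omega> ^^ N) + ?c * ?l \<omega>)"
    using b expectation_linear_term(1)[OF b]
    by (intro integral_mono Bochner_Integration.integrable_add integrable_mult_right
        integrable_continuous[of _ "\<lambda>H. rtrace (affine_op (real N) \<theta> H ^^ N)"] continuous_rtrace_affine) auto
  also have "\<dots> = cosh \<rho> * (LINT \<omega>|M. rtrace (?B b \<omega> ^^ N)) + ?c * (LINT \<omega>|M. ?l \<omega>)"
    using b expectation_linear_term(1)[OF b]
    by (subst Bochner_Integration.integral_add)
      (auto intro!: integrable_mult_right integrable_continuous[of _ "\<lambda>H. rtrace (affine_op (real N) \<theta> H ^^ N)"]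
        continuous_rtrace_affine)
  also have "(LINT \<omega>|M. ?l \<omega>) = 0" by (rule expectation_linear_term(2)[OF b])
  finally show ?thesis by simp
qed

lemma expectation_le:
  assumes "b \<le> q" and \<theta>: "\<theta> > 0" and \<beta>: "real (n + 2) - \<theta> * (real q * R) > 0"
  defines "N \<equiv> n + 2"
  defines "\<rho> \<equiv> real N * (\<theta> * R) / (real N - \<theta> * (real q * R))"
  shows "(LINT \<omega>|M. rtrace (affine_op (real N) \<theta> (A b \<omega>) ^^ N)) \<le> cosh \<rho> ^ b * (2 * real CARD('m) * real N ^ N)"
  using assms(1)
proof (induction b)
  case 0
  have "rtrace (affine_op (real N) \<theta> (A 0 \<omega>) ^^ N) = 2 * real CARD('m) * real N ^ N" if "\<omega> \<in> space M" for \<omega>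
  proof -
    have lin: "linear (affine_op (real N) \<theta> 0)"
      using selfadj_affine_op[of 0] by (simp add: selfadj_def hermitian_def)
    have "affine_op (real N) \<theta> 0 x = real N *\<^sub>R x" for x by (simp add: affine_op_def)
    then have "rtrace (affine_op (real N) \<theta> 0 ^^ N) = (\<Sum>c\<in>(Basis::(complex^'m) set). real N ^ N)"
      by (intro rtrace_funpow[OF onb_Basis lin])
    then show ?thesis using start[OF that] by (simp add: mult.commute)
  qed
  then have "(LINT \<omega>|M. rtrace (affine_op (real N) \<theta> (A 0 \<omega>) ^^ N)) = (LINT \<omega>|M. 2 * real CARD('m) * real N ^ N)"
    by (intro Bochner_Integration.integral_cong refl)
  then show ?case by (simp add: prob_space)
next
  case (Suc b)
  have "(LINT \<omega>|M. rtrace (affine_op (real N) \<theta> (A (Suc b) \<omega>) ^^ N))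
      \<le> cosh \<rho> * (LINT \<omega>|M. rtrace (affine_op (real N) \<theta> (A b \<omega>) ^^ N))"
    unfolding \<rho>_def N_def using Suc.prems by (intro expectation_step \<theta> \<beta>) simp
  also have "\<dots> \<le> cosh \<rho> * (cosh \<rho> ^ b * (2 * real CARD('m) * real N ^ N))"
    using Suc by (intro mult_left_mono) auto
  finally show ?case by (simp add: mult.assoc)
qed

text \<open>Markov's inequality for \<open>tr (N + \<theta> A)\<^sup>N\<close> in the limit \<open>N \<rightarrow> \<infinity>\<close>.\<close>
theorem matrix_azuma:
  assumes \<theta>: "\<theta> > 0" and t: "t \<ge> 0"
  shows "measure M {\<omega> \<in> space M. t \<le> lambda_max (A q \<omega>)} \<le> real CARD('m) * exp (- \<theta> * t) * cosh (\<theta> * R) ^ q"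
proof -
  let ?E = "{\<omega> \<in> space M. t \<le> lambda_max (A q \<omega>)}"
  define K where "K = \<theta> * (real q * R)"
  have finite_N: "prob ?E * (1 + (\<theta> * t) / real N) ^ N
      \<le> real CARD('m) * cosh (real N * (\<theta> * R) / (real N - K)) ^ q"
    if N: "N \<ge> 2" "real N > K" for N
  proof -
    obtain n where n: "N = n + 2" using N(1) by (metis add.commute le_Suc_ex)
    let ?u = "\<lambda>\<omega>. rtrace (affine_op (real N) \<theta> (A q \<omega>) ^^ N)"
    let ?c = "2 * (real N + \<theta> * t) ^ N"
    have int: "integrable M ?u"
      by (intro integrable_continuous[of _ "\<lambda>H. rtrace (affine_op (real N) \<theta> H ^^ N)"] continuous_rtrace_affine) simp
    have c_pos: "?c > 0" using N(1) \<theta> t by (intro mult_pos_pos zero_less_power add_pos_nonneg) auto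
    have low: "2 * (real N + \<theta> * lambda_max (A q \<omega>)) ^ N \<le> ?u \<omega>"
      and pos: "0 \<le> ?u \<omega>" if \<omega>: "\<omega> \<in> space M" for \<omega>
    proof -
      have p: "0 \<le> affine_op (real N) \<theta> (A q \<omega>) x \<bullet> x" for x
        using affine_op_pos[OF order_refl \<omega>, of \<theta> "real N" x] \<theta> N(2)
        by (smt (verit) K_def mult_nonneg_nonneg zero_le_power2)
      show "2 * (real N + \<theta> * lambda_max (A q \<omega>)) ^ N \<le> ?u \<omega>"
        using lambda_max_power_le_rtrace[OF hermitian_A[OF order_refl \<omega>], of "real N" \<theta> N] p
        unfolding affine_op_def[abs_def] by simp
      have sa: "selfadj (affine_op (real N) \<theta> (A q \<omega>))" by (intro selfadj_affine_op hermitian_A \<omega>) simp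
      then have lin: "linear (affine_op (real N) \<theta> (A q \<omega>))" by (simp add: selfadj_def)
      obtain C r where C: "onb C" and r: "\<And>c. c \<in> C \<Longrightarrow> affine_op (real N) \<theta> (A q \<omega>) c = r c *\<^sub>R c"
        using selfadj_eigenbasis[OF sa] by blast
      have "0 \<le> r c" if "c \<in> C" for c
        using p[of c] C that by (simp add: r onb_def norm_eq_1)
      then show "0 \<le> ?u \<omega>" by (simp add: rtrace_funpow[OF C lin r] sum_nonneg)
    qed
    have "prob ?E \<le> prob {\<omega> \<in> space M. ?c \<le> ?u \<omega>}"
    proof (rule finite_measure_mono)
      show "?E \<subseteq> {\<omega> \<in> space M. ?c \<le> ?u \<omega>}"
      proof safe
        fix \<omega> assume \<omega>: "\<omega> \<in> space M" "t \<le> lambda_max (A q \<omega>)"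
        have "?c \<le> 2 * (real N + \<theta> * lambda_max (A q \<omega>)) ^ N"
          using \<theta> t \<omega>(2) by (intro mult_left_mono power_mono add_left_mono) auto
        with low[OF \<omega>(1)] show "?c \<le> ?u \<omega>" by simp
      qed
      show "{\<omega> \<in> space M. ?c \<le> ?u \<omega>} \<in> sets M"
        using borel_measurable_integrable[OF int] by measurable
    qed
    also have "\<dots> \<le> (LINT \<omega>|M. ?u \<omega>) / ?c"
      using integral_Markov_inequality_measure[OF int _ _ c_pos, of "{}"] pos by (auto intro: AE_I2)
    also have "\<dots> \<le> (cosh (real N * (\<theta> * R) / (real N - K)) ^ q * (2 * real CARD('m) * real N ^ N)) / ?c"
      using expectation_le[OF order_refl \<theta>, of n] N(2) c_pos
      by (intro divide_right_mono) (auto simp: n K_def)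
    finally have "prob ?E * (real N + \<theta> * t) ^ N
        \<le> (cosh (real N * (\<theta> * R) / (real N - K)) ^ q * real CARD('m)) * real N ^ N"
      using c_pos by (simp add: pos_le_divide_eq mult_ac)
    then have "prob ?E * (real N + \<theta> * t) ^ N / real N ^ N
        \<le> cosh (real N * (\<theta> * R) / (real N - K)) ^ q * real CARD('m)"
      using N(1) by (simp add: pos_divide_le_eq)
    moreover have "(1 + \<theta> * t / real N) ^ N = (real N + \<theta> * t) ^ N / real N ^ N"
      using N(1) by (simp add: power_divide[symmetric] add_divide_distrib)
    ultimately show ?thesis by (simp add: mult.commute)
  qed
  have lim: "(\<lambda>N. real N * (\<theta> * R) / (real N - K)) \<longlonglongrightarrow> \<theta> * R"
  proof -
    have "(\<lambda>N. (\<theta> * R) / (1 - K * inverse (real N))) \<longlonglongrightarrow> (\<theta> * R) / (1 - K * 0)"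
      by (intro tendsto_intros lim_inverse_n) simp
    moreover have "\<forall>\<^sub>F N in sequentially. (\<theta> * R) / (1 - K * inverse (real N)) = real N * (\<theta> * R) / (real N - K)"
      using eventually_gt_at_top[of 0] by eventually_elim (simp add: field_simps)
    ultimately show ?thesis by (simp add: tendsto_cong)
  qed
  have "prob ?E * exp (\<theta> * t) \<le> real CARD('m) * cosh (\<theta> * R) ^ q"
  proof (rule tendsto_le[OF trivial_limit_sequentially])
    show "(\<lambda>N. prob ?E * (1 + (\<theta> * t) / real N) ^ N) \<longlonglongrightarrow> prob ?E * exp (\<theta> * t)"
      by (intro tendsto_intros tendsto_exp_limit_sequentially)
    show "(\<lambda>N. real CARD('m) * cosh (real N * (\<theta> * R) / (real N - K)) ^ q) \<longlonglongrightarrow> real CARD('m) * cosh (\<theta> * R) ^ q"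
      by (intro tendsto_intros lim)
    have "\<forall>\<^sub>F N in sequentially. K < real N"
      using filterlim_real_sequentially by (simp add: filterlim_at_top_dense)
    then show "\<forall>\<^sub>F N in sequentially. prob ?E * (1 + (\<theta> * t) / real N) ^ N
       \<le> real CARD('m) * cosh (real N * (\<theta> * R) / (real N - K)) ^ q"
      using eventually_ge_at_top[of 2] by eventually_elim (rule finite_N)
  qed
  then have "prob ?E \<le> real CARD('m) * cosh (\<theta> * R) ^ q / exp (\<theta> * t)"
    by (simp add: pos_le_divide_eq)
  then show ?thesis by (simp add: exp_minus divide_inverse mult_ac)
qed

end

section \<open>Curvature and Lipschitz functions\<close>

lemma (in prob_space) abs_diff_integral_le:
  fixes u :: "'a \<Rightarrow> real"
  assumes "integrable M u" "\<And>x. x \<in> space M \<Longrightarrow> \<bar>a - u x\<bar> \<le> c"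
  shows "\<bar>a - integral\<^sup>L M u\<bar> \<le> c"
proof -
  have "a - integral\<^sup>L M u = (\<integral>x. a - u x \<partial>M)"
    using assms(1) by (simp add: prob_space)
  also have "\<bar>\<dots>\<bar> \<le> (\<integral>x. \<bar>a - u x\<bar> \<partial>M)" by (rule integral_abs_bound)
  also have "\<dots> \<le> (\<integral>x. c \<partial>M)"
    using assms by (intro integral_mono) auto
  finally show ?thesis by (simp add: prob_space)
qed

lemma lipschitz_borel:
  fixes u :: "'a::metric_space \<Rightarrow> real"
  assumes "\<And>x y. \<bar>u x - u y\<bar> \<le> c * dist x y"
  shows "u \<in> borel_measurable borel"
proof (rule borel_measurable_continuous_onI)
  have "lipschitz_on (max c 0) UNIV u"
  proof (rule lipschitz_onI)
    fix x y
    have "\<bar>u x - u y\<bar> \<le> c * dist x y" by (rule assms)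
    also have "\<dots> \<le> max c 0 * dist x y" by (intro mult_right_mono) auto
    finally show "dist (u x) (u y) \<le> max c 0 * dist x y" by (simp add: dist_real_def)
  qed simp
  then show "continuous_on UNIV u" by (rule lipschitz_on_continuous_on)
qed

lemma coupling_integral_diff_le:
  fixes \<mu> \<nu> :: "'a::polish_space measure" and u :: "'a \<Rightarrow> real"
  assumes \<mu>: "prob_space \<mu>" "sets \<mu> = sets borel" and \<nu>: "prob_space \<nu>" "sets \<nu> = sets borel"
    and \<pi>: "\<pi> \<in> couplings \<mu> \<nu>" and cost: "(\<integral>\<^sup>+ (x, y). ennreal (dist x y) \<partial>\<pi>) \<le> ennreal w" and "w \<ge> 0"
    and u: "\<And>x y. \<bar>u x - u y\<bar> \<le> c * dist x y" and bd: "\<And>x. \<bar>u x\<bar> \<le> B" and "c \<ge> 0"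
  shows "\<bar>integral\<^sup>L \<mu> u - integral\<^sup>L \<nu> u\<bar> \<le> c * w"
proof -
  have s: "sets \<pi> = sets (\<mu> \<Otimes>\<^sub>M \<nu>)" and d1: "distr \<pi> \<mu> fst = \<mu>" and d2: "distr \<pi> \<nu> snd = \<nu>"
    using \<pi> by (auto simp: couplings_def)
  have s': "sets \<pi> = sets (borel \<Otimes>\<^sub>M borel)"
    using s \<mu>(2) \<nu>(2) by (metis sets_pair_measure_cong)
  have m1: "fst \<in> measurable \<pi> \<mu>" and m2: "snd \<in> measurable \<pi> \<nu>"
    by (simp_all add: measurable_cong_sets[OF s refl])
  have [measurable]: "fst \<in> borel_measurable \<pi>" "snd \<in> borel_measurable \<pi>"
    by (simp_all add: measurable_cong_sets[OF s' refl])
  interpret \<pi>: prob_space \<pi>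
    using prob_space_distrD[OF m1] \<mu>(1) d1 by simp
  have [measurable]: "u \<in> borel_measurable borel" by (rule lipschitz_borel[OF u])
  have um: "u \<in> borel_measurable \<mu>" "u \<in> borel_measurable \<nu>"
    using \<mu>(2) \<nu>(2) by (simp_all add: measurable_cong_sets[OF \<mu>(2) refl] measurable_cong_sets[OF \<nu>(2) refl])
  have i1: "integrable \<pi> (\<lambda>z. u (fst z))" and i2: "integrable \<pi> (\<lambda>z. u (snd z))"
    using bd by (auto intro!: \<pi>.integrable_const_bound[where B = B])
  have di: "integrable \<pi> (\<lambda>z. dist (fst z) (snd z))"
    using cost by (intro integrableI_nonneg) (auto simp: case_prod_unfold intro: le_less_trans)
  have dw: "(\<integral>z. dist (fst z) (snd z) \<partial>\<pi>) \<le> w"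
  proof -
    have "ennreal (\<integral>z. dist (fst z) (snd z) \<partial>\<pi>) \<le> ennreal w"
      using cost by (subst nn_integral_eq_integral[OF di, symmetric]) (auto simp: case_prod_unfold)
    then show ?thesis using \<open>w \<ge> 0\<close> by simp
  qed
  have "integral\<^sup>L \<mu> u = (\<integral>z. u (fst z) \<partial>\<pi>)"
    by (subst d1[symmetric]) (rule integral_distr[OF m1 um(1)])
  moreover have "integral\<^sup>L \<nu> u = (\<integral>z. u (snd z) \<partial>\<pi>)"
    by (subst d2[symmetric]) (rule integral_distr[OF m2 um(2)])
  ultimately have "integral\<^sup>L \<mu> u - integral\<^sup>L \<nu> u = (\<integral>z. u (fst z) - u (snd z) \<partial>\<pi>)"
    using i1 i2 by simp
  also have "\<bar>\<dots>\<bar> \<le> (\<integral>z. \<bar>u (fst z) - u (snd z)\<bar> \<partial>\<pi>)" by (rule integral_abs_bound)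
  also have "\<dots> \<le> (\<integral>z. c * dist (fst z) (snd z) \<partial>\<pi>)"
    using i1 i2 di u by (intro integral_mono) auto
  also have "\<dots> \<le> c * w" using dw \<open>c \<ge> 0\<close> by (simp add: mult_left_mono)
  finally show ?thesis .
qed

text \<open>The easy half of Kantorovich duality: integrate \<open>u a - u b\<close> against nearly optimal
  couplings.\<close>
lemma curvature_contraction:
  fixes K :: "'a::polish_space \<Rightarrow> 'a measure" and u :: "'a \<Rightarrow> real"
  assumes K: "\<And>x. prob_space (K x)" "\<And>x. sets (K x) = sets borel"
    and curv: "0 \<le> curvature K" "curvature K \<le> 1"
    and u: "\<And>x y. \<bar>u x - u y\<bar> \<le> c * dist x y" and bd: "\<And>x. \<bar>u x\<bar> \<le> B" and "c \<ge> 0"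
  shows "\<bar>integral\<^sup>L (K x) u - integral\<^sup>L (K y) u\<bar> \<le> c * (1 - real_of_ereal (curvature K)) * dist x y"
proof (cases "x = y")
  case False
  define k where "k = real_of_ereal (curvature K)"
  have ke: "curvature K = ereal k" and k01: "0 \<le> k" "k \<le> 1"
    unfolding k_def using curv by (cases "curvature K"; simp)+
  define W where "W = W1 (K x) (K y)"
  have d: "dist x y > 0" using False by simp
  have "curvature K \<le> (\<lambda>(x, y). 1 - enn2ereal (W1 (K x) (K y)) / ereal (dist x y)) (x, y)"
    unfolding curvature_def using False by (intro INF_lower) auto
  then have le: "ereal k \<le> 1 - enn2ereal W / ereal (dist x y)" by (simp add: ke W_def)
  have W: "W \<le> ennreal ((1 - k) * dist x y)"
  proof (cases W)
    case (real r)
    then have "k \<le> 1 - r / dist x y" using le d by (simp add: one_ereal_def)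
    then have "r \<le> (1 - k) * dist x y" using d by (simp add: field_simps)
    then show ?thesis using real by (simp add: ennreal_leI)
  next
    case top
    then show ?thesis using le d by (simp add: one_ereal_def)
  qed
  have "\<bar>integral\<^sup>L (K x) u - integral\<^sup>L (K y) u\<bar> \<le> c * ((1 - k) * dist x y) + e" if e: "e > 0" for e
  proof -
    define e' where "e' = e / (c + 1)"
    have e': "e' > 0" unfolding e'_def using e \<open>c \<ge> 0\<close> by simp
    have n: "0 \<le> (1 - k) * dist x y" using k01 by simp
    have "W < ennreal ((1 - k) * dist x y + e')"
      using n e' by (intro le_less_trans[OF W]) (simp add: ennreal_lessI)
    then obtain \<pi> where \<pi>: "\<pi> \<in> couplings (K x) (K y)"
      and "(\<integral>\<^sup>+ (x, y). ennreal (dist x y) \<partial>\<pi>) < ennreal ((1 - k) * dist x y + e')"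
      unfolding W_def W1_def INF_less_iff by blast
    then have "\<bar>integral\<^sup>L (K x) u - integral\<^sup>L (K y) u\<bar> \<le> c * ((1 - k) * dist x y + e')"
      using n e' by (intro coupling_integral_diff_le[OF K K \<pi> _ _ u bd \<open>c \<ge> 0\<close>]) auto
    also have "\<dots> \<le> c * ((1 - k) * dist x y) + e"
    proof -
      have "c * e' = e * (c / (c + 1))" by (simp add: e'_def)
      also have "\<dots> \<le> e * 1" using e \<open>c \<ge> 0\<close> by (intro mult_left_mono) auto
      finally show ?thesis by (simp add: distrib_left)
    qed
    finally show ?thesis .
  qed
  then have "\<bar>integral\<^sup>L (K x) u - integral\<^sup>L (K y) u\<bar> \<le> c * ((1 - k) * dist x y)"
    by (rule field_le_epsilon)
  then show ?thesis by (simp add: k_def mult.assoc)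
qed simp

text \<open>The backward evolution of the chain: \<open>pull P i k h x\<close> is the expectation of \<open>h\<close> at time
  \<open>k + i\<close> when the chain is at \<open>x\<close> at time \<open>k\<close>.\<close>
primrec pull :: "(nat \<Rightarrow> 'a \<Rightarrow> 'a measure) \<Rightarrow> nat \<Rightarrow> nat \<Rightarrow> ('a \<Rightarrow> 'e::{banach, second_countable_topology}) \<Rightarrow> 'a \<Rightarrow> 'e" where
  "pull P 0 k h = h"
| "pull P (Suc i) k h = (\<lambda>x. LINT y|P (Suc k) x. pull P i (Suc k) h y)"

lemma pull_add: "pull P (i + i') k h = pull P i k (pull P i' (k + i) h)"
  by (induction i arbitrary: k) simp_all

locale kernels =
  fixes P :: "nat \<Rightarrow> 'a::polish_space \<Rightarrow> 'a measure"
  assumes kernel: "t \<ge> 1 \<Longrightarrow> P t \<in> borel \<rightarrow>\<^sub>M prob_algebra borel"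
begin

lemma kernel_prob: "t \<ge> 1 \<Longrightarrow> prob_space (P t x)" and kernel_sets: "t \<ge> 1 \<Longrightarrow> sets (P t x) = sets borel"
  using measurable_space[OF kernel, of t x] by (auto simp: space_prob_algebra)

lemma borel_measurable_kernel_integral:
  fixes h :: "'a \<Rightarrow> 'e::{banach, second_countable_topology}"
  assumes "t \<ge> 1" "h \<in> borel_measurable borel"
  shows "(\<lambda>x. integral\<^sup>L (P t x) h) \<in> borel_measurable borel"
  using measurable_compose[OF measurable_prob_algebraD[OF kernel[OF assms(1)]]
      integral_measurable_subprob_algebra[OF assms(2)]] .

lemma borel_measurable_pull:
  fixes h :: "'a \<Rightarrow> 'e::{banach, second_countable_topology}"
  assumes "h \<in> borel_measurable borel"
  shows "pull P i k h \<in> borel_measurable borel"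
proof (induction i arbitrary: k)
  case (Suc i)
  show ?case using borel_measurable_kernel_integral[OF _ Suc, of "Suc k" "Suc k"] by simp
qed (use assms in simp)

lemma integrable_kernel:
  fixes h :: "'a \<Rightarrow> 'e::{banach, second_countable_topology}"
  assumes "t \<ge> 1" "h \<in> borel_measurable borel" "\<And>x. norm (h x) \<le> B"
  shows "integrable (P t x) h"
proof -
  interpret prob_space "P t x" by (rule kernel_prob[OF assms(1)])
  show ?thesis
    using assms by (intro integrable_const_bound[where B = B])
      (auto simp: measurable_cong_sets[OF kernel_sets[OF assms(1)] refl])
qed

lemma norm_pull_le:
  fixes h :: "'a \<Rightarrow> 'e::{banach, second_countable_topology}"
  assumes "h \<in> borel_measurable borel" "\<And>x. norm (h x) \<le> B"
  shows "norm (pull P i k h x) \<le> B"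
proof (induction i arbitrary: k x)
  case (Suc i)
  interpret prob_space "P (Suc k) x" by (rule kernel_prob) simp
  have int: "integrable (P (Suc k) x) (pull P i (Suc k) h)"
    using Suc borel_measurable_pull[OF assms(1)] by (intro integrable_kernel) auto
  have "norm (pull P (Suc i) k h x) \<le> (LINT y|P (Suc k) x. norm (pull P i (Suc k) h y))"
    by (simp add: integral_norm_bound)
  also have "\<dots> \<le> (LINT y|P (Suc k) x. B)"
    using int Suc by (intro integral_mono) auto
  finally show ?case by (simp add: prob_space)
qed (use assms in simp)

text \<open>Reduces statements about matrix-valued functions to real-valued ones.\<close>
lemma bounded_linear_pull:
  fixes h :: "'a \<Rightarrow> 'e::{banach, second_countable_topology}"
  fixes \<phi> :: "'e \<Rightarrow> 'f::{banach, second_countable_topology}"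
  assumes "bounded_linear \<phi>" "h \<in> borel_measurable borel" "\<And>x. norm (h x) \<le> B"
  shows "\<phi> (pull P i k h x) = pull P i k (\<lambda>x. \<phi> (h x)) x"
proof (induction i arbitrary: k x)
  case (Suc i)
  have int: "integrable (P (Suc k) x) (pull P i (Suc k) h)"
    using norm_pull_le[OF assms(2,3)] borel_measurable_pull[OF assms(2)] by (intro integrable_kernel) auto
  show ?case
    using integral_bounded_linear[OF assms(1) int] by (simp add: Suc)
qed simp

lemma abs_diff_pull_le:
  fixes u :: "'a \<Rightarrow> real"
  assumes "u \<in> borel_measurable borel" "\<And>x. \<bar>u x\<bar> \<le> B" "\<And>x. \<bar>a - u x\<bar> \<le> c"
  shows "\<bar>a - pull P i k u y\<bar> \<le> c"
proof (induction i arbitrary: k y)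
  case (Suc i)
  interpret prob_space "P (Suc k) y" by (rule kernel_prob) simp
  have int: "integrable (P (Suc k) y) (pull P i (Suc k) u)"
    using norm_pull_le[of u B] borel_measurable_pull[OF assms(1)] assms(1,2) by (intro integrable_kernel) auto
  show ?case using Suc by (simp add: abs_diff_integral_le[OF int])
qed (use assms in simp)

lemma pull_lipschitz:
  fixes u :: "'a \<Rightarrow> real"
  assumes curv: "\<And>t. t \<ge> 1 \<Longrightarrow> 0 \<le> curvature (P t) \<and> curvature (P t) \<le> 1"
    and u: "\<And>x y. \<bar>u x - u y\<bar> \<le> c * dist x y" and bd: "\<And>x. \<bar>u x\<bar> \<le> B" and "c \<ge> 0"
  shows "\<bar>pull P i k u x - pull P i k u y\<bar>
     \<le> c * (\<Prod>l=Suc k..k + i. 1 - real_of_ereal (curvature (P l))) * dist x y"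
proof (induction i arbitrary: k x y)
  case 0
  then show ?case using u by simp
next
  case (Suc i)
  let ?\<alpha> = "\<lambda>l. 1 - real_of_ereal (curvature (P l))"
  have a0: "0 \<le> ?\<alpha> l" if "l \<ge> 1" for l
    using curv[OF that] by (cases "curvature (P l)") auto
  have "\<bar>integral\<^sup>L (P (Suc k) x) (pull P i (Suc k) u) - integral\<^sup>L (P (Suc k) y) (pull P i (Suc k) u)\<bar>
    \<le> (c * (\<Prod>l=Suc (Suc k)..Suc k + i. ?\<alpha> l)) * ?\<alpha> (Suc k) * dist x y"
  proof (rule curvature_contraction[OF kernel_prob kernel_sets _ _ Suc])
    show "0 \<le> c * (\<Prod>l=Suc (Suc k)..Suc k + i. ?\<alpha> l)"
      using \<open>c \<ge> 0\<close> a0 by (intro mult_nonneg_nonneg prod_nonneg) auto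
    show "\<bar>pull P i (Suc k) u x\<bar> \<le> B" for x
      using norm_pull_le[of u B i "Suc k" x] lipschitz_borel[OF u] bd by simp
  qed (use curv in auto)
  moreover have "(\<Prod>l=Suc k..k + Suc i. ?\<alpha> l) = ?\<alpha> (Suc k) * (\<Prod>l=Suc (Suc k)..Suc k + i. ?\<alpha> l)"
    by (subst prod.atLeast_Suc_atMost) auto
  ultimately show ?case by (simp add: mult_ac)
qed

end

section \<open>Row sums from column sums\<close>

text \<open>Let \<open>r\<close> denote the row sum.  Backwards in time it obeys \<open>r\<^sub>k = 1 + \<alpha>\<^bsub>k+1\<^esub> r\<^bsub>k+1\<^esub>\<close>, while the
  column sum obeys \<open>s\<^bsub>k+1\<^esub> = 1 + \<alpha>\<^bsub>k+1\<^esub> s\<^sub>k\<close> forwards.  The function \<open>2 K - s\<close> bounds the row sum that can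
  still be collected from a state with column sum \<open>s\<close> while the column sum stays below \<open>K\<close>: in the
  extreme case \<open>\<alpha> = 1\<close> until the column sum reaches \<open>K\<close>, and \<open>\<alpha> = 1 - 1 / K\<close> from then on.
  In the induction step, the slack is \<open>(1 - \<alpha>) (2 K - 1 - s - \<alpha> s)\<close>, and both \<open>s\<close> and
  \<open>1 + \<alpha> s\<close> are at most \<open>K\<close>.\<close>
lemma row_sum_plus_column_sum_le:
  fixes \<alpha> s :: "nat \<Rightarrow> real"
  assumes \<alpha>: "\<And>l. l \<ge> 1 \<Longrightarrow> 0 \<le> \<alpha> l \<and> \<alpha> l \<le> 1"
    and s: "s 0 = 1" "\<And>t. s (Suc t) = 1 + \<alpha> (Suc t) * s t" and K: "\<And>t. s t \<le> K"
  shows "(\<Sum>i\<le>m. \<Prod>l=Suc k..k + i. \<alpha> l) + s k \<le> 2 * K"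
proof (induction m arbitrary: k)
  case 0
  have "1 \<le> K" using K[of 0] s(1) by simp
  then show ?case using K[of k] by simp
next
  case (Suc m)
  let ?a = "\<alpha> (Suc k)"
  let ?r = "\<lambda>m k. \<Sum>i\<le>m. \<Prod>l=Suc k..k + i. \<alpha> l"
  have "?r (Suc m) k = 1 + (\<Sum>i\<le>m. \<Prod>l=Suc k..k + Suc i. \<alpha> l)"
    by (subst sum.atMost_Suc_shift) simp
  also have "(\<Sum>i\<le>m. \<Prod>l=Suc k..k + Suc i. \<alpha> l) = ?a * ?r m (Suc k)"
    unfolding sum_distrib_left by (intro sum.cong refl, subst prod.atLeast_Suc_atMost) auto
  also have "?a * ?r m (Suc k) \<le> ?a * (2 * K - s (Suc k))"
    using Suc[of "Suc k"] \<alpha>[of "Suc k"] by (intro mult_left_mono) auto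
  finally have le: "?r (Suc m) k \<le> 1 + ?a * (2 * K - s (Suc k))" by simp
  have "0 \<le> (1 - ?a) * (2 * K - 1 - s k - ?a * s k)"
    using \<alpha>[of "Suc k"] K[of k] K[of "Suc k"] s(2)[of k] by (intro mult_nonneg_nonneg) auto
  then show ?case using le unfolding s(2) by (simp add: algebra_simps)
qed

lemma row_sum_le:
  fixes \<alpha> :: "nat \<Rightarrow> real"
  assumes \<alpha>: "\<And>l. l \<ge> 1 \<Longrightarrow> 0 \<le> \<alpha> l \<and> \<alpha> l \<le> 1" and K: "1 \<le> K"
    and col: "\<And>t. t \<ge> 1 \<Longrightarrow> 1 + (\<Sum>k=1..t. \<Prod>l=k..t. \<alpha> l) \<le> K"
  shows "(\<Sum>j\<in>{k<..n}. \<Prod>l=Suc k..j. \<alpha> l) \<le> 2 * K - 2"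
proof (cases "k \<le> n")
  case True
  define s where "s t = 1 + (\<Sum>k=1..t. \<Prod>l=k..t. \<alpha> l)" for t
  have rec: "s (Suc t) = 1 + \<alpha> (Suc t) * s t" for t
  proof -
    have "(\<Sum>k=1..t. \<Prod>l=k..Suc t. \<alpha> l) = (\<Sum>k=1..t. \<alpha> (Suc t) * (\<Prod>l=k..t. \<alpha> l))"
      by (intro sum.cong refl) (simp add: mult.commute)
    then show ?thesis by (simp add: s_def sum_distrib_left algebra_simps)
  qed
  have "s t \<le> K" for t
    using col[of t] K by (cases "t = 0") (auto simp: s_def)
  from row_sum_plus_column_sum_le[of \<alpha> s, OF \<alpha> _ rec this, where m = "n - k" and k = k]
  have A: "(\<Sum>i\<le>n - k. \<Prod>l=Suc k..k + i. \<alpha> l) + s k \<le> 2 * K" by (simp add: s_def)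
  have "1 \<le> s k" unfolding s_def using \<alpha> by (auto intro!: sum_nonneg prod_nonneg)
  moreover have "(\<Sum>i\<le>n - k. \<Prod>l=Suc k..k + i. \<alpha> l) = (\<Sum>j=k..n. \<Prod>l=Suc k..j. \<alpha> l)"
    by (rule sum.reindex_bij_witness[of _ "\<lambda>j. j - k" "\<lambda>i. k + i"]) (use True in auto)
  moreover have "\<dots> = 1 + (\<Sum>j\<in>{k<..n}. \<Prod>l=Suc k..j. \<alpha> l)"
    using True by (subst sum.head) auto
  ultimately show ?thesis using A by linarith
qed (use K in simp)

section \<open>The Markov property for functions of the future\<close>

lemma space_past [simp]: "space (past M X t) = space M"
  unfolding past_def by (rule space_measure_of) auto

lemma measurable_past:
  assumes "s \<le> t" shows "X s \<in> borel_measurable (past M X t)"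
proof (rule measurableI)
  fix B :: "'b set" assume "B \<in> sets borel"
  then have "X s -` B \<inter> space M \<in> {X s -` A \<inter> space M | s A. s \<le> t \<and> A \<in> sets borel}"
    using assms by blast
  then show "X s -` B \<inter> space (past M X t) \<in> sets (past M X t)"
    unfolding space_past unfolding past_def by (intro in_measure_of) auto
qed simp

lemma sets_past: "sets (past M X t) = sigma_sets (space M) {X s -` A \<inter> space M | s A. s \<le> t \<and> A \<in> sets borel}"
  unfolding past_def by (rule sets_measure_of) auto

lemma subalgebra_past:
  assumes "\<And>t. X t \<in> borel_measurable M"
  shows "subalgebra M (past M X t)"
  unfolding subalgebra_def space_past sets_past
  using assms by (auto intro!: sets.sigma_sets_subset measurable_sets)

lemma subalgebra_past_mono: "s \<le> t \<Longrightarrow> subalgebra (past M X t) (past M X s)"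
  unfolding subalgebra_def space_past sets_past
  by (auto intro!: sigma_sets_mono' intro: order_trans)

locale inhomogeneous_markov_chain =
  fixes M :: "'w measure" and X :: "nat \<Rightarrow> 'w \<Rightarrow> 'a::polish_space" and \<mu>\<^sub>0 P
  assumes chain: "markov_chain M X \<mu>\<^sub>0 P"

sublocale inhomogeneous_markov_chain \<subseteq> prob_space M
  using chain by (simp add: markov_chain_def)

sublocale inhomogeneous_markov_chain \<subseteq> kernels P
  using chain by unfold_locales (simp add: markov_chain_def)

context inhomogeneous_markov_chain
begin

lemma X_measurable [measurable]: "X t \<in> borel_measurable M"
  using chain by (simp add: markov_chain_def)

lemma past_measurable_imp: "Z \<in> measurable (past M X t) N \<Longrightarrow> Z \<in> measurable M N"
  by (rule measurable_from_subalg[OF subalgebra_past[OF X_measurable]])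

text \<open>Bounded weights that are measurable with respect to the past serve as test functions: this
  expresses conditional expectations by ordinary integrals.\<close>
lemma integrable_past_mult:
  fixes h :: "'a \<Rightarrow> 'e::{banach, second_countable_topology}" and Z :: "'w \<Rightarrow> real"
  assumes "Z \<in> borel_measurable (past M X s)" "\<And>\<omega>. \<omega> \<in> space M \<Longrightarrow> \<bar>Z \<omega>\<bar> \<le> C"
    and "h \<in> borel_measurable borel" "\<And>x. norm (h x) \<le> B"
  shows "integrable M (\<lambda>\<omega>. Z \<omega> *\<^sub>R h (X t \<omega>))"
proof (rule integrable_const_bound[where B = "C * B"])
  have [measurable]: "Z \<in> borel_measurable M" using assms(1) by (rule past_measurable_imp)
  note assms(3)[measurable]
  show "(\<lambda>\<omega>. Z \<omega> *\<^sub>R h (X t \<omega>)) \<in> borel_measurable M" by measurable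
  show "AE \<omega> in M. norm (Z \<omega> *\<^sub>R h (X t \<omega>)) \<le> C * B"
    using assms(2,4) by (intro AE_I2) (auto intro!: mult_mono intro: order_trans[OF abs_ge_zero])
qed

lemma integrable_past_mult_kernel:
  fixes Z :: "'w \<Rightarrow> real" and u :: "'a \<Rightarrow> real"
  assumes Z: "Z \<in> borel_measurable (past M X s)" "\<And>\<omega>. \<omega> \<in> space M \<Longrightarrow> \<bar>Z \<omega>\<bar> \<le> C"
    and u: "u \<in> borel_measurable borel" "\<And>x. norm (u x) \<le> B"
  shows "integrable M (\<lambda>\<omega>. Z \<omega> * (LINT y|P (Suc t) (X t \<omega>). u y))"
proof -
  have "integrable M (\<lambda>\<omega>. Z \<omega> *\<^sub>R pull P (Suc 0) t u (X t \<omega>))"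
    by (rule integrable_past_mult[OF Z borel_measurable_pull[OF u(1)] norm_pull_le[OF u]])
  then show ?thesis by simp
qed

lemma one_step_indicator:
  fixes Z :: "'w \<Rightarrow> real"
  assumes Z: "Z \<in> borel_measurable (past M X t)" "\<And>\<omega>. \<omega> \<in> space M \<Longrightarrow> \<bar>Z \<omega>\<bar> \<le> C" and A: "A \<in> sets borel"
  shows "(LINT \<omega>|M. Z \<omega> * indicator A (X (Suc t) \<omega>)) = (LINT \<omega>|M. Z \<omega> * measure (P (Suc t) (X t \<omega>)) A)"
proof -
  interpret S: finite_measure_subalgebra M "past M X t"
    by unfold_locales (rule subalgebra_past[OF X_measurable])
  have [measurable]: "Z \<in> borel_measurable M" using Z(1) by (rule past_measurable_imp)
  note A[measurable]
  let ?g = "\<lambda>\<omega>. indicator A (X (Suc t) \<omega>) :: real"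
  have int: "integrable M (\<lambda>\<omega>. Z \<omega> * ?g \<omega>)"
    using integrable_past_mult[OF Z, of "indicator A :: 'a \<Rightarrow> real" 1 "Suc t"] by (simp add: indicator_def)
  have "(LINT \<omega>|M. Z \<omega> * ?g \<omega>) = (LINT \<omega>|M. Z \<omega> * real_cond_exp M (past M X t) ?g \<omega>)"
    using S.real_cond_exp_intg(2)[OF int Z(1)] by simp
  also have "\<dots> = (LINT \<omega>|M. Z \<omega> * measure (P (Suc t) (X t \<omega>)) A)"
  proof (rule integral_cong_AE)
    show "(\<lambda>\<omega>. Z \<omega> * real_cond_exp M (past M X t) ?g \<omega>) \<in> borel_measurable M" by measurable
    have "(\<lambda>x. measure (P (Suc t) x) A) \<in> borel_measurable borel"
      using kernel[of "Suc t"] A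
      by (intro measurable_compose[OF measurable_prob_algebraD measurable_measure_subprob_algebra]) auto
    then show "(\<lambda>\<omega>. Z \<omega> * measure (P (Suc t) (X t \<omega>)) A) \<in> borel_measurable M" by measurable
    have "\<forall>t\<ge>1. \<forall>A\<in>sets borel. AE \<omega> in M.
        real_cond_exp M (past M X (t - 1)) (\<lambda>\<omega>. indicator A (X t \<omega>)) \<omega> = measure (P t (X (t - 1) \<omega>)) A"
      using chain unfolding markov_chain_def by blast
    from this[rule_format, of "Suc t" A]
    have "AE \<omega> in M. real_cond_exp M (past M X t) ?g \<omega> = measure (P (Suc t) (X t \<omega>)) A"
      using A by simp
    then show "AE \<omega> in M. Z \<omega> * real_cond_exp M (past M X t) ?g \<omega> = Z \<omega> * measure (P (Suc t) (X t \<omega>)) A"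
      by (auto elim!: eventually_mono)
  qed
  finally show ?thesis .
qed

text \<open>The transition probabilities are prescribed on sets; a monotone class argument passes to
  functions.  The bound \<open>B\<close> varies in the induction so that it can be inherited by the pieces of
  \<open>u\<close>.\<close>
lemma one_step_nonneg:
  fixes Z :: "'w \<Rightarrow> real" and u :: "'a \<Rightarrow> real"
  assumes Z: "Z \<in> borel_measurable (past M X t)" "\<And>\<omega>. \<omega> \<in> space M \<Longrightarrow> \<bar>Z \<omega>\<bar> \<le> C"
    and u: "u \<in> borel_measurable borel" "\<And>x. 0 \<le> u x" "\<And>x. u x \<le> B"
  shows "(LINT \<omega>|M. Z \<omega> * u (X (Suc t) \<omega>)) = (LINT \<omega>|M. Z \<omega> * (LINT y|P (Suc t) (X t \<omega>). u y))"
  using u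
proof (induction u arbitrary: B rule: borel_measurable_induct_real)
  case (set A)
  have "(LINT y|P (Suc t) x. indicator A y) = measure (P (Suc t) x) A" for x
    using set kernel_sets[of "Suc t" x] by simp
  then show ?case using one_step_indicator[OF Z set(1)] by simp
next
  case (mult u c)
  show ?case
  proof (cases "c = 0")
    case False
    then have "u x \<le> B / c" for x using mult.prems[of x] mult.hyps(1) by (simp add: field_simps)
    from mult.IH[OF this] show ?thesis by (simp add: mult.left_commute)
  qed simp
next
  case (add u v)
  have b: "u x \<le> B" "v x \<le> B" for x
    using add.prems[of x] add.hyps(2)[of x] add.hyps(4)[of x] by linarith+
  have n: "norm (u x) \<le> B" "norm (v x) \<le> B" for x
    using b[of x] add.hyps(2)[of x] add.hyps(4)[of x] by auto
  have "integrable (P (Suc t) x) u" "integrable (P (Suc t) x) v" for x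
    by (rule integrable_kernel[OF _ add.hyps(1) n(1)] integrable_kernel[OF _ add.hyps(3) n(2)]; simp)+
  moreover have "integrable M (\<lambda>\<omega>. Z \<omega> * u (X (Suc t) \<omega>))" "integrable M (\<lambda>\<omega>. Z \<omega> * v (X (Suc t) \<omega>))"
    using integrable_past_mult[OF Z add.hyps(1) n(1)] integrable_past_mult[OF Z add.hyps(3) n(2)] by auto
  moreover have "integrable M (\<lambda>\<omega>. Z \<omega> * (LINT y|P (Suc t) (X t \<omega>). u y))"
      "integrable M (\<lambda>\<omega>. Z \<omega> * (LINT y|P (Suc t) (X t \<omega>). v y))"
    using integrable_past_mult_kernel[OF Z add.hyps(1) n(1)] integrable_past_mult_kernel[OF Z add.hyps(3) n(2)]
    by simp_all
  ultimately show ?case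
    using add.IH(1)[OF b(1)] add.IH(2)[OF b(2)] by (simp add: distrib_left)
next
  case (seq U)
  have le: "U i x \<le> u x" for i x
    using seq.hyps(3) seq.hyps(4)[of x] by (intro incseq_le) (auto simp: incseq_def le_fun_def)
  have bU: "U i x \<le> B" for i x using le[of i x] seq.prems[of x] by simp
  have nU: "norm (U i x) \<le> B" for i x using bU[of i x] seq.hyps(2)[of i x] by simp
  have lim: "(\<lambda>i. U i x) \<longlonglongrightarrow> u x" for x using seq.hyps(4)[of x] by simp
  note [measurable] = seq.hyps(1) past_measurable_imp[OF Z(1)]
  have [measurable]: "u \<in> borel_measurable borel"
    by (rule borel_measurable_LIMSEQ_real[OF seq.hyps(4) seq.hyps(1)]) 
  have nu: "norm (u x) \<le> B" for x
    using seq.prems[of x] seq.hyps(2)[of 0 x] le[of 0 x] by simp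
  have q: "(\<lambda>i. LINT y|P (Suc t) x. U i y) \<longlonglongrightarrow> (LINT y|P (Suc t) x. u y)" for x
  proof -
    interpret K: prob_space "P (Suc t) x" by (rule kernel_prob) simp
    show ?thesis
      by (rule integral_dominated_convergence[where w = "\<lambda>_. B"])
        (use lim nU in \<open>auto simp: measurable_cong_sets[OF kernel_sets refl]\<close>)
  qed
  have qm: "(\<lambda>x. LINT y|P (Suc t) x. U i y) \<in> borel_measurable borel" "(\<lambda>x. LINT y|P (Suc t) x. u y) \<in> borel_measurable borel" for i
    by (auto intro!: borel_measurable_kernel_integral)
  have nq: "norm (LINT y|P (Suc t) x. U i y) \<le> B" for i x
    using norm_pull_le[OF seq.hyps(1)[of i] nU[of i], where i = "Suc 0" and k = t and x = x] by simp
  note [measurable] = qm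
  have "(\<lambda>i. LINT \<omega>|M. Z \<omega> * U i (X (Suc t) \<omega>)) \<longlonglongrightarrow> (LINT \<omega>|M. Z \<omega> * u (X (Suc t) \<omega>))"
    using Z(2) nU
    by (intro integral_dominated_convergence[where w = "\<lambda>_. C * B"] AE_I2 tendsto_intros lim)
      (auto simp: abs_mult intro!: mult_mono intro: order_trans[OF abs_ge_zero])
  moreover have "(\<lambda>i. LINT \<omega>|M. Z \<omega> * (LINT y|P (Suc t) (X t \<omega>). U i y)) \<longlonglongrightarrow> (LINT \<omega>|M. Z \<omega> * (LINT y|P (Suc t) (X t \<omega>). u y))"
    using Z(2) nq
    by (intro integral_dominated_convergence[where w = "\<lambda>_. C * B"] AE_I2 tendsto_intros q)
      (auto simp: abs_mult intro!: mult_mono intro: order_trans[OF abs_ge_zero])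
  ultimately show ?case
    using seq.IH[OF bU] by (simp add: LIMSEQ_unique)
qed

lemma one_step_real:
  fixes Z :: "'w \<Rightarrow> real" and u :: "'a \<Rightarrow> real"
  assumes Z: "Z \<in> borel_measurable (past M X t)" "\<And>\<omega>. \<omega> \<in> space M \<Longrightarrow> \<bar>Z \<omega>\<bar> \<le> C"
    and u: "u \<in> borel_measurable borel" "\<And>x. \<bar>u x\<bar> \<le> B"
  shows "(LINT \<omega>|M. Z \<omega> * u (X (Suc t) \<omega>)) = (LINT \<omega>|M. Z \<omega> * (LINT y|P (Suc t) (X t \<omega>). u y))"
proof -
  let ?v = "\<lambda>x. u x + B"
  have v: "?v \<in> borel_measurable borel" "0 \<le> ?v x" "?v x \<le> 2 * B" for x
    using u(1) u(2)[of x] by auto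
  have iu: "integrable (P (Suc t) x) u" for x
    by (rule integrable_kernel[OF _ u(1), of _ B]) (use u(2) in auto)
  have i1: "integrable M (\<lambda>\<omega>. Z \<omega> * u (X (Suc t) \<omega>))"
    using integrable_past_mult[OF Z u(1), of B "Suc t"] u(2) by simp
  have i2: "integrable M (\<lambda>\<omega>. Z \<omega> * (LINT y|P (Suc t) (X t \<omega>). u y))"
    using integrable_past_mult_kernel[OF Z u(1), of B] u(2) by simp
  have i3: "integrable M (\<lambda>\<omega>. Z \<omega> * B)"
    using integrable_past_mult[OF Z, of "\<lambda>_. B" "\<bar>B\<bar>" t] by simp
  have one: "(LINT y|P (Suc t) x. u y + B) = (LINT y|P (Suc t) x. u y) + B" for x
  proof -
    interpret K: prob_space "P (Suc t) x" by (rule kernel_prob) simp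
    show ?thesis using iu by (simp add: K.prob_space)
  qed
  show ?thesis
    using one_step_nonneg[OF Z v] i1 i2 i3 by (simp add: distrib_left one)
qed

lemma markov_property:
  fixes Z :: "'w \<Rightarrow> real" and h :: "'a \<Rightarrow> 'e::euclidean_space"
  assumes Z: "Z \<in> borel_measurable (past M X k)" "\<And>\<omega>. \<omega> \<in> space M \<Longrightarrow> \<bar>Z \<omega>\<bar> \<le> C"
    and h: "h \<in> borel_measurable borel" "\<And>x. norm (h x) \<le> B"
  shows "(LINT \<omega>|M. Z \<omega> *\<^sub>R h (X (k + i) \<omega>)) = (LINT \<omega>|M. Z \<omega> *\<^sub>R pull P i k h (X k \<omega>))"
  using Z
proof (induction i arbitrary: k)
  case (Suc i)
  let ?g = "pull P i (Suc k) h"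
  have g: "?g \<in> borel_measurable borel" "norm (?g x) \<le> B" for x
    using borel_measurable_pull[OF h(1)] norm_pull_le[OF h] by auto
  have Z': "Z \<in> borel_measurable (past M X (Suc k))"
    using measurable_from_subalg[OF subalgebra_past_mono Suc.prems(1)] by simp
  have "(LINT \<omega>|M. Z \<omega> *\<^sub>R h (X (k + Suc i) \<omega>)) = (LINT \<omega>|M. Z \<omega> *\<^sub>R ?g (X (Suc k) \<omega>))"
    using Suc.IH[OF Z' Suc.prems(2)] by simp
  also have "\<dots> = (LINT \<omega>|M. Z \<omega> *\<^sub>R pull P (Suc i) k h (X k \<omega>))"
  proof (rule euclidean_eqI)
    fix b :: 'e assume b: "b \<in> Basis"
    have bl: "bounded_linear (\<lambda>x. x \<bullet> b)" by (rule bounded_linear_inner_left)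
    have gb: "(\<lambda>x. ?g x \<bullet> b) \<in> borel_measurable borel" "\<bar>?g x \<bullet> b\<bar> \<le> B" for x
      using g b by (auto intro: order_trans[OF Basis_le_norm])
    have i1: "integrable M (\<lambda>\<omega>. Z \<omega> *\<^sub>R ?g (X (Suc k) \<omega>))"
      by (rule integrable_past_mult[OF Suc.prems g])
    have i2: "integrable M (\<lambda>\<omega>. Z \<omega> *\<^sub>R pull P (Suc i) k h (X k \<omega>))"
      by (rule integrable_past_mult[OF Suc.prems borel_measurable_pull[OF h(1)] norm_pull_le[OF h]])
    have ig: "integrable (P (Suc k) x) ?g" for x
      by (rule integrable_kernel[OF _ g]) simp
    have "(LINT \<omega>|M. Z \<omega> *\<^sub>R ?g (X (Suc k) \<omega>)) \<bullet> b = (LINT \<omega>|M. Z \<omega> * (?g (X (Suc k) \<omega>) \<bullet> b))"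
      using integral_bounded_linear[OF bl i1] by simp
    also have "\<dots> = (LINT \<omega>|M. Z \<omega> * (LINT y|P (Suc k) (X k \<omega>). ?g y \<bullet> b))"
      by (rule one_step_real[OF Suc.prems gb])
    also have "\<dots> = (LINT \<omega>|M. (Z \<omega> *\<^sub>R pull P (Suc i) k h (X k \<omega>)) \<bullet> b)"
      using integral_bounded_linear[OF bl ig] by simp
    also have "\<dots> = (LINT \<omega>|M. Z \<omega> *\<^sub>R pull P (Suc i) k h (X k \<omega>)) \<bullet> b"
      by (rule integral_bounded_linear[OF bl i2])
    finally show "(LINT \<omega>|M. Z \<omega> *\<^sub>R ?g (X (Suc k) \<omega>)) \<bullet> b = (LINT \<omega>|M. Z \<omega> *\<^sub>R pull P (Suc i) k h (X k \<omega>)) \<bullet> b" .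
  qed
  finally show ?case .
qed simp

end

section \<open>The Doob martingale of the sum\<close>

locale lipschitz_observables = inhomogeneous_markov_chain M X \<mu>\<^sub>0 P
  for M :: "'w measure" and X :: "nat \<Rightarrow> 'w \<Rightarrow> 'a::polish_space" and \<mu>\<^sub>0 P +
  fixes F :: "nat \<Rightarrow> 'a \<Rightarrow> complex^'m::finite^'m" and L D :: real
  assumes hermitian_F: "j \<ge> 1 \<Longrightarrow> hermitian (F j x)"
    and lipschitz_F: "j \<ge> 1 \<Longrightarrow> norm ((F j x - F j y) *v v) \<le> L * dist x y * norm v"
    and diameter: "dist (x :: 'a) y \<le> D"
    and curvature_bounds: "t \<ge> 1 \<Longrightarrow> 0 \<le> curvature (P t) \<and> curvature (P t) \<le> 1"
    and L_nonneg: "L \<ge> 0"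
begin

abbreviation (input) "\<alpha> \<equiv> \<lambda>l. 1 - real_of_ereal (curvature (P l))"

lemma contraction_bounds: "l \<ge> 1 \<Longrightarrow> 0 \<le> \<alpha> l \<and> \<alpha> l \<le> 1"
  using curvature_bounds[of l] by (cases "curvature (P l)") auto

lemma D_nonneg: "D \<ge> 0"
  using diameter[of undefined undefined] by simp

lemma norm_F_diff_le: 
  assumes "j \<ge> 1" shows "norm (F j x - F j y) \<le> real CARD('m) * (real CARD('m) * (L * dist x y))"
  by (intro norm_matrix_le lipschitz_F assms)

lemma borel_measurable_F:
  assumes "j \<ge> 1" shows "F j \<in> borel_measurable borel"
proof (rule borel_measurable_continuous_onI)
  have "lipschitz_on (real CARD('m) * (real CARD('m) * L)) UNIV (F j)"
    using norm_F_diff_le[OF assms] L_nonneg by (intro lipschitz_onI) (auto simp: dist_norm mult.assoc)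
  then show "continuous_on UNIV (F j)" by (rule lipschitz_on_continuous_on)
qed

text \<open>A crude bound, for integrability.\<close>
definition F_bound :: "nat \<Rightarrow> real" where
  "F_bound j = norm (F j undefined) + real CARD('m) * (real CARD('m) * (L * D))"

lemma norm_F_le:
  assumes "j \<ge> 1" shows "norm (F j x) \<le> F_bound j"
proof -
  have "norm (F j x) \<le> norm (F j undefined) + norm (F j x - F j undefined)"
    by (metis add.commute diff_add_cancel norm_triangle_ineq)
  also have "norm (F j x - F j undefined) \<le> real CARD('m) * (real CARD('m) * (L * dist x undefined))"
    by (rule norm_F_diff_le[OF assms])
  also have "\<dots> \<le> real CARD('m) * (real CARD('m) * (L * D))"
    by (intro mult_left_mono diameter L_nonneg) auto
  finally show ?thesis by (simp add: F_bound_def)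
qed

text \<open>For \<open>j \<le> \<tau>\<close> the truncated difference \<open>j - \<tau>\<close> is 0, and the forecast is the observable \<open>F j\<close>
  itself.\<close>
definition forecast :: "nat \<Rightarrow> nat \<Rightarrow> 'a \<Rightarrow> complex^'m^'m" where
  "forecast \<tau> j = pull P (j - \<tau>) \<tau> (F j)"

text \<open>The conditional expectation of \<open>F j (X j)\<close> given the past up to time \<open>\<tau>\<close>; for \<open>j \<le> \<tau>\<close> it is
  the observed value.\<close>
definition estimate :: "nat \<Rightarrow> nat \<Rightarrow> 'w \<Rightarrow> complex^'m^'m" where
  "estimate \<tau> j \<omega> = forecast \<tau> j (X (min j \<tau>) \<omega>)"

definition doob :: "nat \<Rightarrow> nat \<Rightarrow> 'w \<Rightarrow> complex^'m^'m" where
  "doob n \<tau> \<omega> = (\<Sum>j=1..n. estimate \<tau> j \<omega> - (LINT \<omega>'|M. F j (X j \<omega>')))"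

lemma borel_measurable_forecast: "j \<ge> 1 \<Longrightarrow> forecast \<tau> j \<in> borel_measurable borel"
  unfolding forecast_def by (intro borel_measurable_pull borel_measurable_F)

lemma norm_forecast_le: "j \<ge> 1 \<Longrightarrow> norm (forecast \<tau> j x) \<le> F_bound j"
  unfolding forecast_def by (intro norm_pull_le borel_measurable_F norm_F_le)

lemma estimate_past_measurable:
  assumes "j \<ge> 1" shows "estimate \<tau> j \<in> borel_measurable (past M X \<tau>)"
  using measurable_compose[OF measurable_past[of "min j \<tau>" \<tau> X M] borel_measurable_forecast[OF assms, of \<tau>]]
  by (simp add: estimate_def[abs_def])

lemma integrable_estimate:
  assumes "j \<ge> 1" "Z \<in> borel_measurable (past M X \<sigma>)" "\<And>\<omega>. \<omega> \<in> space M \<Longrightarrow> \<bar>Z \<omega>\<bar> \<le> C"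
  shows "integrable M (\<lambda>\<omega>. Z \<omega> *\<^sub>R estimate \<tau> j \<omega>)"
  unfolding estimate_def
  by (rule integrable_past_mult[OF assms(2,3) borel_measurable_forecast norm_forecast_le]) (use assms in auto)

lemma expectation_estimate:
  assumes "j \<ge> 1" and Z: "Z \<in> borel_measurable (past M X \<sigma>)" "\<And>\<omega>. \<omega> \<in> space M \<Longrightarrow> \<bar>Z \<omega>\<bar> \<le> C"
    and "\<sigma> \<le> \<tau>"
  shows "(LINT \<omega>|M. Z \<omega> *\<^sub>R estimate \<tau> j \<omega>) = (LINT \<omega>|M. Z \<omega> *\<^sub>R F j (X j \<omega>))"
proof (cases "j \<le> \<tau>")
  case True
  then show ?thesis by (simp add: estimate_def forecast_def min_def)
next
  case False
  have "Z \<in> borel_measurable (past M X \<tau>)"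
    using measurable_from_subalg[OF subalgebra_past_mono[OF \<open>\<sigma> \<le> \<tau>\<close>] Z(1)] .
  from markov_property[OF this Z(2) borel_measurable_F[OF assms(1)] norm_F_le[OF assms(1)], of "j - \<tau>"]
  show ?thesis using False by (simp add: estimate_def forecast_def min_def)
qed

text \<open>For \<open>j \<le> \<tau>\<close> the product is empty, and \<open>L * D\<close> is the oscillation of the observable \<open>F j\<close>
  itself.\<close>
definition oscillation :: "nat \<Rightarrow> nat \<Rightarrow> real" where
  "oscillation \<tau> j = L * D * (\<Prod>l=Suc \<tau>..j. \<alpha> l)"

lemma oscillation_nonneg: "0 \<le> oscillation \<tau> j"
  unfolding oscillation_def using L_nonneg D_nonneg contraction_bounds
  by (intro mult_nonneg_nonneg prod_nonneg) auto

lemma bounded_linear_form: "bounded_linear (\<lambda>H::complex^'m^'m. (H *v v) \<bullet> w)"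
  by (rule bounded_linear_compose[OF bounded_linear_inner_left matrix_vector.bounded_linear_left])

lemma form_measurable:
  "h \<in> borel_measurable N \<Longrightarrow> (\<lambda>x. (h x *v v) \<bullet> w) \<in> borel_measurable N" for h :: "'z \<Rightarrow> complex^'m^'m"
  by (rule measurable_compose[OF _ borel_measurable_continuous_onI[OF linear_continuous_on[OF bounded_linear_form]]])

lemma form_bound:
  obtains K where "\<And>H::complex^'m^'m. \<bar>(H *v v) \<bullet> w\<bar> \<le> K * norm H" "K \<ge> 0"
proof -
  obtain K where "K \<ge> 0" "\<And>H::complex^'m^'m. norm ((H *v v) \<bullet> w) \<le> norm H * K"
    using bounded_linear.nonneg_bounded[OF bounded_linear_form[of v w]] by blast
  then show ?thesis by (intro that[of K]) (auto simp: mult.commute)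
qed

lemma form_forecast:
  assumes "j \<ge> 1"
  shows "(forecast \<tau> j x *v v) \<bullet> w = pull P (j - \<tau>) \<tau> (\<lambda>x. (F j x *v v) \<bullet> w) x"
  unfolding forecast_def
  by (rule bounded_linear_pull[OF bounded_linear_form borel_measurable_F norm_F_le]) (use assms in auto)

text \<open>Testing a matrix against two vectors turns the operator Lipschitz bound into a Lipschitz bound for
  a real function, to which the contraction by curvature applies.\<close>
lemma form_oscillation_le:
  assumes "j \<ge> 1"
  shows "\<bar>(forecast \<tau> j x *v v) \<bullet> w - (forecast \<tau> j y *v v) \<bullet> w\<bar> \<le> oscillation \<tau> j * norm v * norm w"
proof -
  let ?u = "\<lambda>x. (F j x *v v) \<bullet> w"
  obtain K where K: "\<And>H::complex^'m^'m. \<bar>(H *v v) \<bullet> w\<bar> \<le> K * norm H" "K \<ge> 0"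
    using form_bound[of v w] by blast
  have bd: "\<bar>?u x\<bar> \<le> K * F_bound j" for x
    using K(1)[of "F j x"] norm_F_le[OF assms, of x] K(2) by (meson mult_left_mono order_trans)
  have lip: "\<bar>?u x - ?u y\<bar> \<le> (L * norm v * norm w) * dist x y" for x y
  proof -
    have "?u x - ?u y = ((F j x - F j y) *v v) \<bullet> w"
      by (simp add: matrix_vector_mult_diff_rdistrib inner_diff_left)
    also have "\<bar>\<dots>\<bar> \<le> norm ((F j x - F j y) *v v) * norm w" by (rule Cauchy_Schwarz_ineq2)
    also have "\<dots> \<le> (L * dist x y * norm v) * norm w"
      by (intro mult_right_mono lipschitz_F assms) simp
    finally show ?thesis by (simp add: mult_ac)
  qed
  have "\<bar>pull P (j - \<tau>) \<tau> ?u x - pull P (j - \<tau>) \<tau> ?u y\<bar>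
     \<le> (L * norm v * norm w) * (\<Prod>l=Suc \<tau>..\<tau> + (j - \<tau>). \<alpha> l) * dist x y"
    using L_nonneg by (intro pull_lipschitz[OF curvature_bounds lip bd]) auto
  also have "\<dots> \<le> (L * norm v * norm w) * (\<Prod>l=Suc \<tau>..\<tau> + (j - \<tau>). \<alpha> l) * D"
    using L_nonneg contraction_bounds by (intro mult_left_mono diameter mult_nonneg_nonneg prod_nonneg) auto
  also have "(\<Prod>l=Suc \<tau>..\<tau> + (j - \<tau>). \<alpha> l) = (\<Prod>l=Suc \<tau>..j. \<alpha> l)"
    by (cases "\<tau> \<le> j") auto
  finally show ?thesis by (simp add: form_forecast[OF assms] oscillation_def mult_ac)
qed

text \<open>A forecast made earlier is an average of forecasts made later, so the two differ by at most the
  oscillation of the later one.\<close>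
lemma forecast_pull:
  assumes "\<tau> \<le> \<tau>'" "\<tau> \<le> j"
  shows "\<exists>i. forecast \<tau> j = pull P i \<tau> (forecast \<tau>' j)"
proof (cases "j \<le> \<tau>'")
  case True
  then show ?thesis by (auto simp: forecast_def)
next
  case False
  then have e: "j - \<tau> = (\<tau>' - \<tau>) + (j - \<tau>')" and e': "\<tau> + (\<tau>' - \<tau>) = \<tau>'"
    using assms by simp_all
  have "forecast \<tau> j = pull P (\<tau>' - \<tau>) \<tau> (forecast \<tau>' j)"
    unfolding forecast_def e pull_add e' ..
  then show ?thesis by blast
qed

lemma form_estimate_diff_le:
  assumes "j \<ge> 1" "\<tau> \<le> \<tau>'"
  shows "\<bar>((estimate \<tau>' j \<omega> - estimate \<tau> j \<omega>) *v v) \<bullet> w\<bar> \<le> (if j \<le> \<tau> then 0 else oscillation \<tau>' j * norm v * norm w)"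
proof (cases "j \<le> \<tau>")
  case True
  then show ?thesis using assms by (simp add: estimate_def forecast_def min_def)
next
  case False
  let ?u = "\<lambda>x. (forecast \<tau>' j x *v v) \<bullet> w"
  obtain i where i: "forecast \<tau> j = pull P i \<tau> (forecast \<tau>' j)"
    using forecast_pull[OF assms(2), of j] False by auto
  obtain K where K: "\<And>H::complex^'m^'m. \<bar>(H *v v) \<bullet> w\<bar> \<le> K * norm H" "K \<ge> 0"
    using form_bound[of v w] by blast
  have bd: "\<bar>?u x\<bar> \<le> K * F_bound j" for x
    using K(1)[of "forecast \<tau>' j x"] norm_forecast_le[OF assms(1), of \<tau>' x] K(2)
    by (meson mult_left_mono order_trans)
  have eq: "(forecast \<tau> j x *v v) \<bullet> w = pull P i \<tau> ?u x" for x
    unfolding i by (rule bounded_linear_pull[OF bounded_linear_form borel_measurable_forecast norm_forecast_le])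
      (use assms in auto)
  have le: "\<bar>?u x - pull P i \<tau> ?u y\<bar> \<le> oscillation \<tau>' j * norm v * norm w" for x y
    by (rule abs_diff_pull_le[OF form_measurable[OF borel_measurable_forecast[OF assms(1)]] bd form_oscillation_le[OF assms(1)]])
  have "((estimate \<tau>' j \<omega> - estimate \<tau> j \<omega>) *v v) \<bullet> w
      = ?u (X (min j \<tau>') \<omega>) - pull P i \<tau> ?u (X (min j \<tau>) \<omega>)"
    unfolding estimate_def matrix_vector_mult_diff_rdistrib inner_diff_left eq ..
  then show ?thesis using False le[of "X (min j \<tau>') \<omega>" "X (min j \<tau>) \<omega>"] by (simp only: if_False)
qed

lemma mean_estimate:
  assumes "j \<ge> 1" shows "(LINT \<omega>|M. estimate \<tau> j \<omega>) = (LINT \<omega>|M. F j (X j \<omega>))"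
  using expectation_estimate[OF assms, of "\<lambda>_. 1" 0 1 \<tau>] by simp

lemma integrable_estimate1: "j \<ge> 1 \<Longrightarrow> integrable M (estimate \<tau> j)"
  using integrable_estimate[of j "\<lambda>_. 1" 0 1 \<tau>] by simp

lemma form_estimate_mean_le:
  assumes "j \<ge> 1"
  shows "\<bar>((estimate \<tau> j \<omega> - (LINT \<omega>'|M. F j (X j \<omega>'))) *v v) \<bullet> w\<bar> \<le> oscillation \<tau> j * norm v * norm w"
proof -
  have "((LINT \<omega>'|M. F j (X j \<omega>')) *v v) \<bullet> w = (LINT \<omega>'|M. (estimate \<tau> j \<omega>' *v v) \<bullet> w)"
    unfolding mean_estimate[OF assms, of \<tau>, symmetric]
    by (rule integral_bounded_linear[OF bounded_linear_form integrable_estimate1[OF assms], symmetric])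
  moreover have "\<bar>(estimate \<tau> j \<omega> *v v) \<bullet> w - (LINT \<omega>'|M. (estimate \<tau> j \<omega>' *v v) \<bullet> w)\<bar> \<le> oscillation \<tau> j * norm v * norm w"
    by (rule abs_diff_integral_le[OF integrable_bounded_linear[OF bounded_linear_form integrable_estimate1[OF assms]]])
      (simp add: estimate_def form_oscillation_le[OF assms])
  ultimately show ?thesis by (simp add: matrix_vector_mult_diff_rdistrib inner_diff_left)
qed

text \<open>Being Hermitian is the vanishing of continuous real-linear maps and is therefore preserved by
  averages.\<close>
lemma hermitian_iff_form: "hermitian H \<longleftrightarrow> (\<forall>i j. H $ i $ j - cnj (H $ j $ i) = 0)"
  unfolding hermitian_def right_minus_eq ..

lemma bounded_linear_skew_entry: "bounded_linear (\<lambda>H::complex^'m^'m. H $ a $ b - cnj (H $ b $ a))"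
  by (intro bounded_linear_sub bounded_linear_compose[OF bounded_linear_vec_nth bounded_linear_vec_nth]
      bounded_linear_compose[OF bounded_linear_cnj bounded_linear_compose[OF bounded_linear_vec_nth bounded_linear_vec_nth]])

lemma hermitian_forecast:
  assumes "j \<ge> 1" shows "hermitian (forecast \<tau> j x)"
proof -
  have z: "pull P i k (\<lambda>_. 0 :: complex) x = 0" for i k x
    by (induction i arbitrary: k x) simp_all
  have h0: "F j x $ a $ b - cnj (F j x $ b $ a) = 0" for a b x
    using hermitian_F[OF assms, of x] unfolding hermitian_iff_form by blast
  have "forecast \<tau> j x $ a $ b - cnj (forecast \<tau> j x $ b $ a) = 0" for a b
    unfolding forecast_def
    by (subst bounded_linear_pull[OF bounded_linear_skew_entry borel_measurable_F[OF assms] norm_F_le[OF assms]])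
      (simp only: h0 z)
  then show ?thesis unfolding hermitian_iff_form by blast
qed

lemma hermitian_zero: "hermitian (0 :: complex^'m^'m)"
  by (simp add: hermitian_def)

lemma hermitian_sum: "(\<And>i. i \<in> I \<Longrightarrow> hermitian (G i)) \<Longrightarrow> hermitian (sum G I)" for G :: "'i \<Rightarrow> complex^'m^'m"
proof (induction I rule: infinite_finite_induct)
  case (insert i I)
  then show ?case by (simp add: hermitian_combine)
qed (simp_all add: hermitian_zero)

lemma hermitian_doob: "hermitian (doob n \<tau> \<omega>)"
proof -
  have "hermitian (LINT \<omega>'|M. F j (X j \<omega>'))" if j: "j \<ge> 1" for j
  proof -
    have h0: "estimate j j \<omega>' $ a $ b - cnj (estimate j j \<omega>' $ b $ a) = 0" for a b \<omega>'
      using hermitian_forecast[OF j] unfolding hermitian_iff_form estimate_def by blast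
    have "(LINT \<omega>'|M. estimate j j \<omega>') $ a $ b - cnj ((LINT \<omega>'|M. estimate j j \<omega>') $ b $ a) = 0" for a b
      using integral_bounded_linear[OF bounded_linear_skew_entry integrable_estimate1[OF j, of j], of a b]
      by (simp only: h0 integral_zero)
    then show ?thesis unfolding mean_estimate[OF j] hermitian_iff_form by blast
  qed
  then show ?thesis
    unfolding doob_def estimate_def by (intro hermitian_sum hermitian_combine hermitian_forecast) auto
qed

lemma doob_past_measurable: "doob n \<tau> \<in> borel_measurable (past M X \<tau>)"
  unfolding doob_def[abs_def]
  by (intro borel_measurable_sum borel_measurable_diff estimate_past_measurable borel_measurable_const) auto

text \<open>Observables up to time \<open>\<tau>\<close> are already known and do not contribute.\<close>
definition step_weight :: "nat \<Rightarrow> nat \<Rightarrow> nat \<Rightarrow> real" where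
  "step_weight n \<tau> \<tau>' = (\<Sum>j\<in>{\<tau><..n}. oscillation \<tau>' j)"

lemma step_weight_nonneg: "0 \<le> step_weight n \<tau> \<tau>'"
  unfolding step_weight_def by (intro sum_nonneg oscillation_nonneg)

lemma norm_matrix_vector_le_form:
  assumes "\<And>w. \<bar>(H *v v) \<bullet> w\<bar> \<le> c * norm v * norm w" "c \<ge> 0"
  shows "norm ((H :: complex^'m^'m) *v v) \<le> c * norm v"
proof (cases "H *v v = 0")
  case False
  then show ?thesis using assms(1)[of "H *v v"]
    by (simp add: power2_norm_eq_inner[symmetric] power2_eq_square)
qed (use assms(2) in simp)

lemma doob_increment_le:
  assumes "\<tau> \<le> \<tau>'"
  shows "norm ((doob n \<tau>' \<omega> - doob n \<tau> \<omega>) *v v) \<le> step_weight n \<tau> \<tau>' * norm v"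
proof (rule norm_matrix_vector_le_form[OF _ step_weight_nonneg])
  fix w
  let ?d = "\<lambda>j. ((estimate \<tau>' j \<omega> - estimate \<tau> j \<omega>) *v v) \<bullet> w"
  have "doob n \<tau>' \<omega> - doob n \<tau> \<omega> = (\<Sum>j=1..n. estimate \<tau>' j \<omega> - estimate \<tau> j \<omega>)"
    by (simp add: doob_def sum_subtractf[symmetric])
  then have "((doob n \<tau>' \<omega> - doob n \<tau> \<omega>) *v v) \<bullet> w = (\<Sum>j=1..n. ?d j)"
    by (simp add: matrix_vector.sum_left inner_sum_left)
  also have "\<bar>\<dots>\<bar> \<le> (\<Sum>j=1..n. \<bar>?d j\<bar>)" by (rule sum_abs)
  also have "\<dots> \<le> (\<Sum>j=1..n. if j \<le> \<tau> then 0 else oscillation \<tau>' j * norm v * norm w)"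
    by (intro sum_mono form_estimate_diff_le assms) auto
  also have "\<dots> = (\<Sum>j\<in>{\<tau><..n}. oscillation \<tau>' j * norm v * norm w)"
    by (rule sum.mono_neutral_cong_right) auto
  finally show "\<bar>((doob n \<tau>' \<omega> - doob n \<tau> \<omega>) *v v) \<bullet> w\<bar> \<le> step_weight n \<tau> \<tau>' * norm v * norm w"
    by (simp add: step_weight_def sum_distrib_right)
qed

text \<open>The step from the deterministic mean to time \<open>\<tau>\<close> obeys the same bound as a step from time 0, so
  no separate increment is spent on the initial distribution.\<close>
lemma doob_first_le: "norm (doob n \<tau> \<omega> *v v) \<le> step_weight n 0 \<tau> * norm v"
proof (rule norm_matrix_vector_le_form[OF _ step_weight_nonneg])
  fix w
  let ?d = "\<lambda>j. ((estimate \<tau> j \<omega> - (LINT \<omega>'|M. F j (X j \<omega>'))) *v v) \<bullet> w"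
  have "(doob n \<tau> \<omega> *v v) \<bullet> w = (\<Sum>j=1..n. ?d j)"
    by (simp add: doob_def matrix_vector.sum_left inner_sum_left)
  also have "\<bar>\<dots>\<bar> \<le> (\<Sum>j=1..n. \<bar>?d j\<bar>)" by (rule sum_abs)
  also have "\<dots> \<le> (\<Sum>j=1..n. oscillation \<tau> j * norm v * norm w)"
    by (intro sum_mono form_estimate_mean_le) auto
  also have "{1..n} = {0<..n}" by auto
  finally show "\<bar>(doob n \<tau> \<omega> *v v) \<bullet> w\<bar> \<le> step_weight n 0 \<tau> * norm v * norm w"
    by (simp add: step_weight_def sum_distrib_right)
qed

lemma doob_martingale:
  assumes Z: "Z \<in> borel_measurable (past M X \<tau>)" "\<And>\<omega>. \<omega> \<in> space M \<Longrightarrow> \<bar>Z \<omega>\<bar> \<le> C" and "\<tau> \<le> \<tau>'"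
  shows "(LINT \<omega>|M. Z \<omega> *\<^sub>R (doob n \<tau>' \<omega> - doob n \<tau> \<omega>)) = 0"
proof -
  have "(LINT \<omega>|M. Z \<omega> *\<^sub>R (doob n \<tau>' \<omega> - doob n \<tau> \<omega>))
      = (LINT \<omega>|M. (\<Sum>j=1..n. Z \<omega> *\<^sub>R estimate \<tau>' j \<omega> - Z \<omega> *\<^sub>R estimate \<tau> j \<omega>))"
    by (simp add: doob_def sum_subtractf[symmetric] scaleR_sum_right scaleR_diff_right)
  also have "\<dots> = (\<Sum>j=1..n. (LINT \<omega>|M. Z \<omega> *\<^sub>R estimate \<tau>' j \<omega>) - (LINT \<omega>|M. Z \<omega> *\<^sub>R estimate \<tau> j \<omega>))"
    using integrable_estimate[OF _ Z]
    by (subst Bochner_Integration.integral_sum) (auto intro!: sum.cong)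
  also have "\<dots> = 0"
    using expectation_estimate[OF _ Z] \<open>\<tau> \<le> \<tau>'\<close> by (intro sum.neutral) auto
  finally show ?thesis .
qed

lemma doob_mean: "(LINT \<omega>|M. doob n \<tau> \<omega>) = 0"
  unfolding doob_def
  by (subst Bochner_Integration.integral_sum)
    (auto simp: integrable_estimate1 mean_estimate prob_space intro!: sum.neutral)

section \<open>Observation in blocks\<close>

text \<open>The martingale starts at the constant 0 instead of the conditional expectation given \<open>X 0\<close>; the last
  block is cut off at time \<open>n\<close>.\<close>
lemma block_martingale:
  assumes R: "R > 0" and q: "\<And>b. b < q \<Longrightarrow> step_weight n (min (b * l) n) (min (Suc b * l) n) \<le> R"
  shows "matrix_martingale M (\<lambda>b \<omega>. if b = 0 then 0 else doob n (min (b * l) n) \<omega>) q R"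
proof
  let ?\<tau> = "\<lambda>b. min (b * l) n"
  let ?A = "\<lambda>b \<omega>. if b = 0 then 0 else doob n (?\<tau> b) \<omega>"
  have mono: "?\<tau> b \<le> ?\<tau> (Suc b)" for b by (intro min.mono) auto
  show "?A b \<in> borel_measurable M" for b
    using past_measurable_imp[OF doob_past_measurable[of n "?\<tau> b"]] by (cases "b = 0") simp_all
  show "hermitian (?A b \<omega>)" for b \<omega>
    using hermitian_doob by (simp add: hermitian_zero)
  show "norm ((?A (Suc b) \<omega> - ?A b \<omega>) *v x) \<le> R * norm x" if "b < q" for b \<omega> x
  proof -
    have "norm ((?A (Suc b) \<omega> - ?A b \<omega>) *v x) \<le> step_weight n (?\<tau> b) (?\<tau> (Suc b)) * norm x"
      using doob_increment_le[OF mono[of b], where n = n and \<omega> = \<omega> and v = x]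
        doob_first_le[of n "?\<tau> 1" \<omega> x] by (cases "b = 0") auto
    also have "\<dots> \<le> R * norm x" using q[OF that] by (intro mult_right_mono) auto
    finally show ?thesis .
  qed
  show "(LINT \<omega>|M. \<zeta> (?A b \<omega>) *\<^sub>R (?A (Suc b) \<omega> - ?A b \<omega>)) = 0"
    if "b < q" and cont: "continuous_on UNIV \<zeta>" for b and \<zeta> :: "complex^'m^'m \<Rightarrow> real"
  proof (cases "b = 0")
    case True
    then show ?thesis using doob_mean[of n "?\<tau> 1"] by simp
  next
    case False
    let ?Z = "\<lambda>\<omega>. \<zeta> (doob n (?\<tau> b) \<omega>)"
    have "compact (\<zeta> ` cball 0 (real CARD('m) * (real CARD('m) * step_weight n 0 (?\<tau> b))))"
      using cont by (intro compact_continuous_image) (auto intro: continuous_on_subset)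
    then obtain C where C: "\<And>H. norm H \<le> real CARD('m) * (real CARD('m) * step_weight n 0 (?\<tau> b)) \<Longrightarrow> \<bar>\<zeta> H\<bar> \<le> C"
      using compact_imp_bounded bounded_iff by (metis image_eqI mem_cball_0 real_norm_def)
    have Z: "?Z \<in> borel_measurable (past M X (?\<tau> b))"
      by (rule measurable_compose[OF doob_past_measurable borel_measurable_continuous_onI[OF cont]])
    have "\<bar>?Z \<omega>\<bar> \<le> C" for \<omega>
      by (intro C norm_matrix_le doob_first_le)
    from doob_martingale[OF Z this mono] show ?thesis using False by simp
  qed
qed (use R in auto)

lemma doob_final: "doob n n \<omega> = (\<Sum>j=1..n. F j (X j \<omega>) - (LINT \<omega>'|M. F j (X j \<omega>')))"
  unfolding doob_def estimate_def forecast_def by (intro sum.cong) (auto simp: min_def)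

text \<open>The optimal parameter in \<open>exp (- \<theta> t + \<theta>\<^sup>2 V / 2)\<close> is \<open>\<theta> = t / V\<close>.\<close>
lemma block_tail:
  assumes R: "R > 0" and blocks: "\<And>b. b < q \<Longrightarrow> step_weight n (min (b * l) n) (min (Suc b * l) n) \<le> R"
    and q: "q \<ge> 1" "n \<le> q * l" and V: "V > 0" "real q * R\<^sup>2 \<le> V" and t: "t > 0"
  shows "measure M {\<omega> \<in> space M. t \<le> lambda_max (\<Sum>j=1..n. F j (X j \<omega>) - (LINT \<omega>'|M. F j (X j \<omega>')))}
     \<le> real CARD('m) * exp (- (t\<^sup>2 / (2 * V)))"
proof -
  interpret A: matrix_martingale M "\<lambda>b \<omega>. if b = 0 then 0 else doob n (min (b * l) n) \<omega>" q R
    by (rule block_martingale[OF R blocks])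
  define \<theta> where "\<theta> = t / V"
  have \<theta>: "\<theta> > 0" using t V by (simp add: \<theta>_def)
  have "measure M {\<omega> \<in> space M. t \<le> lambda_max (doob n n \<omega>)} \<le> real CARD('m) * exp (- \<theta> * t) * cosh (\<theta> * R) ^ q"
  proof -
    have "min (q * l) n = n" "q \<noteq> 0" using q by auto
    then show ?thesis using A.matrix_azuma[OF \<theta>, of t] t by simp
  qed
  also have "\<dots> \<le> real CARD('m) * exp (- \<theta> * t) * exp ((\<theta> * R)\<^sup>2 / 2) ^ q"
    by (intro mult_left_mono power_mono cosh_le_exp_square) auto
  also have "\<dots> = real CARD('m) * exp (- \<theta> * t + \<theta>\<^sup>2 * (real q * R\<^sup>2) / 2)"
    by (simp add: exp_of_nat_mult[symmetric] exp_add[symmetric] power_mult_distrib mult_ac)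
  also have "\<dots> \<le> real CARD('m) * exp (- \<theta> * t + \<theta>\<^sup>2 * V / 2)"
    using V(2) by (intro mult_left_mono iffD2[OF exp_le_cancel_iff] add_left_mono divide_right_mono) auto
  also have "- \<theta> * t + \<theta>\<^sup>2 * V / 2 = - (t\<^sup>2 / (2 * V))"
    using V(1) by (simp add: \<theta>_def field_simps power2_eq_square)
  finally show ?thesis by (simp add: doob_final)
qed

lemma step_weight_le:
  assumes "\<tau> \<le> \<tau>'" "\<tau>' \<le> n" and K: "1 \<le> K"
    and col: "\<And>t. t \<ge> 1 \<Longrightarrow> 1 + (\<Sum>k=1..t. \<Prod>l=k..t. \<alpha> l) \<le> K"
  shows "step_weight n \<tau> \<tau>' \<le> L * D * (real (\<tau>' - \<tau>) + (2 * K - 2))"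
proof -
  have "{\<tau><..n} = {\<tau><..\<tau>'} \<union> {\<tau>'<..n}" using assms by auto
  then have "step_weight n \<tau> \<tau>' = (\<Sum>j\<in>{\<tau><..\<tau>'}. oscillation \<tau>' j) + (\<Sum>j\<in>{\<tau>'<..n}. oscillation \<tau>' j)"
    unfolding step_weight_def by (subst sum.union_disjoint[symmetric]) auto
  also have "(\<Sum>j\<in>{\<tau><..\<tau>'}. oscillation \<tau>' j) = (\<Sum>j\<in>{\<tau><..\<tau>'}. L * D)"
    by (intro sum.cong refl) (simp add: oscillation_def)
  also have "(\<Sum>j\<in>{\<tau>'<..n}. oscillation \<tau>' j) = L * D * (\<Sum>j\<in>{\<tau>'<..n}. \<Prod>l=Suc \<tau>'..j. \<alpha> l)"
    by (simp add: oscillation_def sum_distrib_left)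
  also have "\<dots> \<le> L * D * (2 * K - 2)"
    using L_nonneg D_nonneg
    by (intro mult_left_mono row_sum_le[OF contraction_bounds K col]) auto
  finally show ?thesis by (simp add: algebra_simps)
qed

lemma step_weight_whole: "step_weight n 0 n = L * D * real n"
  by (simp add: step_weight_def oscillation_def mult.commute)

text \<open>Blocks have length \<open>l = \<lceil>K\<rceil>\<close>.  If \<open>n \<le> l\<close>, one block suffices, with the trivial increment bound
  \<open>L D n\<close>.  Otherwise there are \<open>q \<le> 2 n / K\<close> blocks with increments of at most
  \<open>L D (l + 2 K - 2) \<le> 3 L D K\<close>.\<close>
lemma tail_bound:
  assumes K: "1 \<le> K" and col: "\<And>t. t \<ge> 1 \<Longrightarrow> 1 + (\<Sum>k=1..t. \<Prod>l=k..t. \<alpha> l) \<le> K"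
    and "L > 0" "D > 0" "n \<ge> 1" and t: "t > 0" and V: "18 * real n * K * (L * D)\<^sup>2 \<le> V"
  shows "measure M {\<omega> \<in> space M. t \<le> lambda_max (\<Sum>j=1..n. F j (X j \<omega>) - (LINT \<omega>'|M. F j (X j \<omega>')))}
     \<le> real CARD('m) * exp (- (t\<^sup>2 / (2 * V)))"
proof -
  have LD: "L * D > 0" using assms by simp
  have V0: "V > 0" using V assms by (intro less_le_trans[OF _ V] mult_pos_pos zero_less_power) auto
  define l where "l = nat \<lceil>K\<rceil>"
  have l: "K \<le> real l" "real l < K + 1" "l \<ge> 1" unfolding l_def using K by linarith+
  show ?thesis
  proof (cases "n \<le> l")
    case True
    have "real n \<le> 18 * K" using True l(2) K by linarith
    have "real 1 * (L * D * real n)\<^sup>2 = (L * D)\<^sup>2 * (real n * real n)"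
      by (simp add: power2_eq_square mult_ac)
    also have "\<dots> \<le> (L * D)\<^sup>2 * (real n * (18 * K))"
      by (intro mult_left_mono \<open>real n \<le> 18 * K\<close>) auto
    also have "\<dots> \<le> V" using V by (simp add: mult_ac)
    finally have "real 1 * (L * D * real n)\<^sup>2 \<le> V" .
    then show ?thesis
      using LD \<open>n \<ge> 1\<close> by (intro block_tail[where q = 1 and l = n and R = "L * D * real n"] V0 t) (auto simp: step_weight_whole)
  next
    case False
    define q where "q = (n + l - 1) div l"
    have q: "n \<le> q * l" "q * l \<le> n + l - 1"
    proof -
      have "n + l - 1 < Suc q * l" unfolding q_def using l(3) by (metis dividend_less_div_times mult_Suc mult.commute less_le_trans zero_less_one add.commute)
      then show "n \<le> q * l" by simp
      show "q * l \<le> n + l - 1" unfolding q_def by (rule div_times_less_eq_dividend)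
    qed
    have q1: "q \<ge> 1" using q(1) \<open>n \<ge> 1\<close> by (cases q) auto
    have "real q * K \<le> real (q * l)" using l(1) by (simp add: mult_left_mono)
    also have "\<dots> \<le> 2 * real n" using q(2) False by linarith
    finally have qK: "real q * K \<le> 2 * real n" .
    have "step_weight n (min (b * l) n) (min (Suc b * l) n) \<le> 3 * (L * D) * K" for b
    proof -
      have "step_weight n (min (b * l) n) (min (Suc b * l) n)
          \<le> L * D * (real (min (Suc b * l) n - min (b * l) n) + (2 * K - 2))"
        by (intro step_weight_le K col min.mono) auto
      also have "\<dots> \<le> L * D * (3 * K)"
      proof (intro mult_left_mono)
        have "min (Suc b * l) n - min (b * l) n \<le> l" by (auto simp: min_def)
        then have "real (min (Suc b * l) n - min (b * l) n) \<le> real l" by simp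
        then show "real (min (Suc b * l) n - min (b * l) n) + (2 * K - 2) \<le> 3 * K"
          using l(2) by linarith
      qed (use LD in simp)
      finally show ?thesis by (simp add: mult_ac)
    qed
    moreover have "real q * (3 * (L * D) * K)\<^sup>2 \<le> V"
    proof -
      have "real q * (3 * (L * D) * K)\<^sup>2 = (real q * K) * (9 * K * (L * D)\<^sup>2)"
        by (simp add: power2_eq_square mult_ac)
      also have "\<dots> \<le> (2 * real n) * (9 * K * (L * D)\<^sup>2)"
        using K by (intro mult_right_mono qK) auto
      also have "\<dots> \<le> V" using V by (simp add: mult_ac)
      finally show ?thesis .
    qed
    ultimately show ?thesis
      using LD K by (intro block_tail[OF _ _ q1 q(1) V0 _ t]) auto
  qed
qed

end

section \<open>Concentration of the sum\<close>

text \<open>Makes \<open>18 \<pi>\<^sup>2 \<le> 192\<close> available.  If \<open>\<pi>\<close> were larger, then \<open>sin (13/24) < sin (\<pi>/6) = 1/2\<close>,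
  which contradicts \<open>x - x\<^sup>3 / 6 \<le> sin x\<close>.\<close>
lemma pi_le: "pi \<le> 13 / 4"
proof (rule ccontr)
  assume "\<not> pi \<le> 13 / 4"
  then have gt: "13 / 24 < pi / 6" by simp
  have "\<bar>sin (13 / 24) - (\<Sum>m<3. sin_coeff m * (13 / 24 :: real) ^ m)\<bar> \<le> inverse (fact 3) * \<bar>13 / 24\<bar> ^ 3"
    by (rule Maclaurin_sin_bound)
  then have "\<bar>sin (13 / 24) - 13 / 24\<bar> \<le> (2197 / 82944 :: real)"
    by (simp add: sin_coeff_def eval_nat_numeral)
  then have "1 / 2 < sin (13 / 24 :: real)" by linarith
  moreover have "sin (13 / 24) < sin (pi / 6)"
    using gt by (intro sin_monotone_2pi) auto
  ultimately show False by (simp add: sin_30)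
qed

theorem theorem7:
  fixes M :: "'w measure"
    and X :: "nat \<Rightarrow> 'w \<Rightarrow> 'a::polish_space"
    and \<mu>\<^sub>0 :: "'a measure"
    and P :: "nat \<Rightarrow> 'a \<Rightarrow> 'a measure"
    and F :: "nat \<Rightarrow> 'a \<Rightarrow> complex^'m::finite^'m"
    and \<kappa> D L v \<epsilon> :: real
    and n :: nat
  assumes "markov_chain M X \<mu>\<^sub>0 P"
    and "\<And>t x. t \<ge> 1 \<Longrightarrow> hermitian (F t x)"
    and "\<And>t. t \<ge> 1 \<Longrightarrow> 0 \<le> curvature (P t) \<and> curvature (P t) \<le> 1"
    and "0 < \<kappa>" and "\<kappa> \<le> 1"
    and "\<And>t. t \<ge> 1 \<Longrightarrow>
           1 + (\<Sum>k=1..t. \<Prod>l=k..t. (1 - real_of_ereal (curvature (P l)))) \<le> 1 / \<kappa>"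
    and "bdd_above (range (\<lambda>(x::'a, y). dist x y))"
    and "D = (SUP (x::'a, y). dist x y)"
    and "L > 0"
    and "\<And>t. t \<ge> 1 \<Longrightarrow> op_Lip (F t) \<le> ennreal L"
    and "v\<^sup>2 = 192 / pi\<^sup>2 * (L\<^sup>2 * D\<^sup>2 / \<kappa>)"
    and "n \<ge> 1"
    and "\<epsilon> \<ge> 0"
  shows "measure M {\<omega> \<in> space M.
             lambda_max (\<Sum>j=1..n. F j (X j \<omega>) - (LINT \<omega>'|M. F j (X j \<omega>'))) \<ge> real n * \<epsilon>}
           \<le> real CARD('m) powr (2 - pi / 4) * exp (- (real n * \<epsilon>\<^sup>2 / (2 * v\<^sup>2)))"
proof -
  interpret prob_space M using assms(1) by (simp add: markov_chain_def)
  have diam: "dist x y \<le> D" for x y :: 'a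
    unfolding assms(8) using assms(7) cSUP_upper[of "(x, y)" UNIV "\<lambda>(x::'a, y). dist x y"] by simp
  have lip: "norm ((F j x - F j y) *v w) \<le> L * dist x y * norm w" if j: "j \<ge> 1" for j x y w
  proof (cases "x = y")
    case False
    have "ennreal (op_norm (F j x - F j y) / dist x y) \<le> op_Lip (F j)"
      unfolding op_Lip_def using False by (intro SUP_upper2[of "(x, y)"]) auto
    also have "\<dots> \<le> ennreal L" by (rule assms(10)[OF j])
    finally have "op_norm (F j x - F j y) / dist x y \<le> L" using assms(9) by simp
    then have "op_norm (F j x - F j y) \<le> L * dist x y" using False by (simp add: field_simps)
    moreover have "norm ((F j x - F j y) *v w) \<le> op_norm (F j x - F j y) * norm w"
      unfolding op_norm_def by (rule onorm) (rule matrix_vector.bounded_linear_right)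
    ultimately show ?thesis by (meson mult_right_mono norm_ge_zero order_trans)
  qed simp
  interpret lipschitz_observables M X \<mu>\<^sub>0 P F L D
    by unfold_locales (use assms(1,2,3,9) diam lip in auto)
  \<comment> \<open>On a one-point space the curvature is \<open>\<infinity>\<close>, which exceeds 1.\<close>
  have D: "D > 0"
  proof (rule ccontr)
    assume "\<not> D > 0"
    then have "x = y" for x y :: 'a
      using diam[of x y] by (metis dist_le_zero_iff not_less order_trans)
    then have "{(x::'a, y). x \<noteq> y} = {}" by auto
    then have "curvature (P 1) = \<infinity>" by (simp add: curvature_def top_ereal_def)
    then show False using assms(3)[of 1] by simp
  qed
  have pi2: "pi\<^sup>2 * 18 \<le> 192"
  proof -
    have "pi\<^sup>2 \<le> (13 / 4)\<^sup>2" using pi_le by (intro power_mono) auto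
    then show ?thesis by (simp add: power2_eq_square)
  qed
  have card: "real CARD('m) \<le> real CARD('m) powr (2 - pi / 4)"
  proof -
    have "real CARD('m) powr 1 \<le> real CARD('m) powr (2 - pi / 4)"
      using pi_less_4 by (intro powr_mono) (auto simp: Suc_leI)
    then show ?thesis by simp
  qed
  show ?thesis
  proof (cases "\<epsilon> = 0")
    case True
    have "1 \<le> real CARD('m)" by (simp add: Suc_leI)
    then have "measure M A \<le> real CARD('m) powr (2 - pi / 4)" for A
      using prob_le_1[of A] card by linarith
    then show ?thesis using True by simp
  next
    case False
    have "18 * real n * (1 / \<kappa>) * (L * D)\<^sup>2 \<le> real n * v\<^sup>2"
    proof -
      have "18 \<le> 192 / pi\<^sup>2" using pi2 by (simp add: pos_le_divide_eq mult.commute)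
      then have "18 * (real n * (L\<^sup>2 * D\<^sup>2 / \<kappa>)) \<le> 192 / pi\<^sup>2 * (real n * (L\<^sup>2 * D\<^sup>2 / \<kappa>))"
        using assms(4) by (intro mult_right_mono) auto
      then show ?thesis unfolding assms(11) by (simp add: power_mult_distrib mult_ac)
    qed
    then have "measure M {\<omega> \<in> space M. real n * \<epsilon> \<le> lambda_max (\<Sum>j=1..n. F j (X j \<omega>) - (LINT \<omega>'|M. F j (X j \<omega>')))}
      \<le> real CARD('m) * exp (- ((real n * \<epsilon>)\<^sup>2 / (2 * (real n * v\<^sup>2))))"
      using assms(4,5,6,9,12,13) D False by (intro tail_bound[where K = "1 / \<kappa>"]) auto
    also have "(real n * \<epsilon>)\<^sup>2 / (2 * (real n * v\<^sup>2)) = real n * \<epsilon>\<^sup>2 / (2 * v\<^sup>2)"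
      using assms(12) by (simp add: power2_eq_square)
    also have "real CARD('m) * exp (- (real n * \<epsilon>\<^sup>2 / (2 * v\<^sup>2)))
        \<le> real CARD('m) powr (2 - pi / 4) * exp (- (real n * \<epsilon>\<^sup>2 / (2 * v\<^sup>2)))"
      using card by (intro mult_right_mono) auto
    finally show ?thesis .
  qed
qed

end
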